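(* Let $E$ be a complex Banach space and $\mathcal{A}$ a standard operator algebra on $E$. Fix a finite sequence $(i_1,\dots,i_m)$ with $\{i_1,\dots,i_m\}=\{1,\dots,k\}$, $k\ge 2$, such that some index $i_p$ occurs exactly once in the sequence, and consider the generalized product $T_1*\cdots*T_k=T_{i_1}\cdots T_{i_m}$ and the generalized Jordan product $T_1\circ\cdots\circ T_k=T_{i_1}\cdots T_{i_m}+T_{i_m}\cdots T_{i_1}$. Let $\phi:\mathcal{A}\to\mathcal{A}$ be a map (not assumed linear, additive or continuous). (i) Suppose the range of $\phi$ contains all operators on $E$ of rank at most two, and for any $a_1,\dots,a_k\in\mathcal{A}$ of which at least one has rank at most one there is an algebra automorphism $\theta_{a_1,\dots,a_k}$ of $\mathcal{A}$ with $\phi(a_1)*\cdots*\phi(a_k)=\theta_{a_1,\dots,a_k}(a_1*\cdots*a_k)$. (ii) Or suppose the range of $\phi$ contains all operators on $E$ of rank at most three, and for any $a_1,\dots,a_k\in\mathcal{A}$ of which at least one has rank at most one there is a linear Jordan automorphism $\theta_{a_1,\dots,a_k}$ of $\mathcal{A}$ with $\phi(a_1)\circ\cdots\circ\phi(a_k)=\theta_{a_1,\dots,a_k}(a_1\circ\cdots\circ a_k)$. In either case, there is a complex scalar $\xi$ with $\xi^m=1$ such that $\phi$ has either the form $A\mapsto \xi SAS^{-1}$ for an invertible bounded linear operator $S:E\to E$, or the form $A\mapsto \xi SA'S^{-1}$ for an invertible bounded linear operator $S:E'\to E$.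
   Context: $\mathcal{B}(E)$ is the algebra of bounded linear operators on $E$, $\mathcal{F}(E)$ its subalgebra of finite rank operators; a standard operator algebra on $E$ is a subalgebra of $\mathcal{B}(E)$ containing $\mathcal{F}(E)$. An algebra automorphism is a bijective linear multiplicative map. A linear Jordan automorphism is a bijective linear map $J$ with $J(ab+ba)=J(a)J(b)+J(b)J(a)$ for all $a,b$. $E'$ denotes the Banach dual of $E$ and $A':E'\to E'$ the dual (adjoint) operator of $A\in\mathcal{B}(E)$. *)

theory Defs
  imports "HOL-Analysis.Analysis"
begin

text \<open>A complex Banach space is modelled as a real Banach space (type class banach)
  together with a complex scalar multiplication smul extending the real one
  and satisfying the module axioms and absolute homogeneity of the norm.\<close>

definition complex_banach_scaling :: "(complex \<Rightarrow> 'a::banach \<Rightarrow> 'a) \<Rightarrow> bool" where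
  "complex_banach_scaling smul \<longleftrightarrow>
     (\<forall>r x. smul (complex_of_real r) x = r *\<^sub>R x) \<and>
     (\<forall>c x y. smul c (x + y) = smul c x + smul c y) \<and>
     (\<forall>c d x. smul (c + d) x = smul c x + smul d x) \<and>
     (\<forall>c d x. smul (c * d) x = smul c (smul d x)) \<and>
     (\<forall>c x. norm (smul c x) = norm c * norm x)"

definition bounded_clinear_op :: "(complex \<Rightarrow> 'a::banach \<Rightarrow> 'a) \<Rightarrow> ('a \<Rightarrow> 'a) \<Rightarrow> bool" where
  "bounded_clinear_op smul T \<longleftrightarrow> bounded_linear T \<and> (\<forall>c x. T (smul c x) = smul c (T x))"

definition cspan_list :: "(complex \<Rightarrow> 'a::banach \<Rightarrow> 'a) \<Rightarrow> 'a list \<Rightarrow> 'a set" where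
  "cspan_list smul vs = {(\<Sum>i<length vs. smul (c i) (vs ! i)) | c. True}"

definition rank_le :: "(complex \<Rightarrow> 'a::banach \<Rightarrow> 'a) \<Rightarrow> ('a \<Rightarrow> 'a) \<Rightarrow> nat \<Rightarrow> bool" where
  "rank_le smul T n \<longleftrightarrow> (\<exists>vs. length vs \<le> n \<and> range T \<subseteq> cspan_list smul vs)"

definition finite_rank :: "(complex \<Rightarrow> 'a::banach \<Rightarrow> 'a) \<Rightarrow> ('a \<Rightarrow> 'a) \<Rightarrow> bool" where
  "finite_rank smul T \<longleftrightarrow> (\<exists>n. rank_le smul T n)"

definition standard_operator_algebra :: "(complex \<Rightarrow> 'a::banach \<Rightarrow> 'a) \<Rightarrow> ('a \<Rightarrow> 'a) set \<Rightarrow> bool" where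
  "standard_operator_algebra smul \<A> \<longleftrightarrow>
     (\<forall>T\<in>\<A>. bounded_clinear_op smul T) \<and>
     (\<forall>S\<in>\<A>. \<forall>T\<in>\<A>. (\<lambda>x. S x + T x) \<in> \<A>) \<and>
     (\<forall>S\<in>\<A>. \<forall>T\<in>\<A>. S \<circ> T \<in> \<A>) \<and>
     (\<forall>c. \<forall>T\<in>\<A>. (\<lambda>x. smul c (T x)) \<in> \<A>) \<and>
     {T. bounded_clinear_op smul T \<and> finite_rank smul T} \<subseteq> \<A>"

definition alg_linear_bij :: "(complex \<Rightarrow> 'a::banach \<Rightarrow> 'a) \<Rightarrow> ('a \<Rightarrow> 'a) set
     \<Rightarrow> (('a \<Rightarrow> 'a) \<Rightarrow> ('a \<Rightarrow> 'a)) \<Rightarrow> bool" where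
  "alg_linear_bij smul \<A> \<theta> \<longleftrightarrow> bij_betw \<theta> \<A> \<A> \<and>
     (\<forall>S\<in>\<A>. \<forall>T\<in>\<A>. \<theta> (\<lambda>x. S x + T x) = (\<lambda>x. \<theta> S x + \<theta> T x)) \<and>
     (\<forall>c. \<forall>T\<in>\<A>. \<theta> (\<lambda>x. smul c (T x)) = (\<lambda>x. smul c (\<theta> T x)))"

definition algebra_automorphism where
  "algebra_automorphism smul \<A> \<theta> \<longleftrightarrow> alg_linear_bij smul \<A> \<theta> \<and>
     (\<forall>S\<in>\<A>. \<forall>T\<in>\<A>. \<theta> (S \<circ> T) = \<theta> S \<circ> \<theta> T)"

definition jordan_automorphism where
  "jordan_automorphism smul \<A> \<theta> \<longleftrightarrow> alg_linear_bij smul \<A> \<theta> \<and>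
     (\<forall>S\<in>\<A>. \<forall>T\<in>\<A>. \<theta> (\<lambda>x. S (T x) + T (S x)) = (\<lambda>x. \<theta> S (\<theta> T x) + \<theta> T (\<theta> S x)))"

definition gen_prod :: "nat list \<Rightarrow> (nat \<Rightarrow> ('a \<Rightarrow> 'a)) \<Rightarrow> ('a \<Rightarrow> 'a)" where
  "gen_prod is T = foldr (\<circ>) (map T is) id"

definition gen_jordan_prod :: "nat list \<Rightarrow> (nat \<Rightarrow> ('a::plus \<Rightarrow> 'a)) \<Rightarrow> ('a \<Rightarrow> 'a)" where
  "gen_jordan_prod is T = (\<lambda>x. gen_prod is T x + gen_prod (rev is) T x)"

definition cdual :: "(complex \<Rightarrow> 'a::banach \<Rightarrow> 'a) \<Rightarrow> ('a \<Rightarrow> complex) set" where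
  "cdual smul = {f. bounded_linear f \<and> (\<forall>c x. f (smul c x) = c * f x)}"

definition invertible_op :: "(complex \<Rightarrow> 'a::banach \<Rightarrow> 'a) \<Rightarrow> ('a \<Rightarrow> 'a) \<Rightarrow> bool" where
  "invertible_op smul S \<longleftrightarrow> bounded_clinear_op smul S \<and> bij S"

definition invertible_dual_op :: "(complex \<Rightarrow> 'a::banach \<Rightarrow> 'a) \<Rightarrow> (('a \<Rightarrow> complex) \<Rightarrow> 'a) \<Rightarrow> bool" where
  "invertible_dual_op smul S \<longleftrightarrow> bij_betw S (cdual smul) UNIV \<and>
     (\<forall>f\<in>cdual smul. \<forall>g\<in>cdual smul. S (\<lambda>x. f x + g x) = S f + S g) \<and>
     (\<forall>c. \<forall>f\<in>cdual smul. S (\<lambda>x. c * f x) = smul c (S f)) \<and>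
     (\<exists>K. \<forall>f\<in>cdual smul. norm (S f) \<le> K * onorm f)"

end

theory Submission
  imports Defs "HOL-Library.Groups_Big_Fun"
begin

text \<open>Giving all variables other than the one that occurs once the same value A turns the product into
  \<open>A\<^sup>r B A\<^sup>s\<close> with \<open>r + s + 1 = m\<close>. Algebra and Jordan automorphisms preserve operators of rank one and
  their traces, so \<open>\<phi>(A)\<^bsup>r+s\<^esup> \<phi>(B)\<close> and \<open>A\<^bsup>r+s\<^esup> B\<close> have the same trace as soon as A or B and \<open>\<phi>(A)\<close> or
  \<open>\<phi>(B)\<close> have rank one; hence \<open>\<phi>\<close> is linear on operators of rank one. For a rank one idempotent P, the
  power \<open>\<phi>(P)\<^bsup>m\<^esup>\<close> is a rank one idempotent; a nonzero nilpotent part of \<open>\<phi>(P)\<close> would be detected by a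
  suitable operator of rank two (or three) in the range of \<open>\<phi>\<close>. So \<open>\<phi>\<close> preserves rank one and, up to a
  root of unity, the trace form \<open>tr (A B)\<close>. Comparing trace forms gives
  \<open>\<phi>(x \<otimes> f) = \<phi>(x \<otimes> f\<^sub>0) \<phi>(x\<^sub>0 \<otimes> f)\<close> for all x and f, or the same with the factors exchanged, that is,
  \<open>x \<otimes> f \<mapsto> S x \<otimes> C f\<close> or \<open>x \<otimes> f \<mapsto> S f \<otimes> C x\<close>. The trace form extends this to the whole algebra, and
  the range condition makes S bijective and, by Hahn-Banach and Baire, bounded.\<close>

section \<open>The Hahn-Banach theorem and weak boundedness\<close>

definition sublinear :: "('a::real_vector \<Rightarrow> real) \<Rightarrow> bool" where
  "sublinear p \<longleftrightarrow> (\<forall>x y. p (x + y) \<le> p x + p y) \<and> (\<forall>c x. 0 \<le> c \<longrightarrow> p (c *\<^sub>R x) = c * p x)"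

lemma sublinearI:
  assumes subadditive: "\<And>x y. p (x + y) \<le> p x + p y"
    and scale_le: "\<And>c x. 0 < c \<Longrightarrow> p (c *\<^sub>R x) \<le> c * p x"
  shows "sublinear p"
proof -
  have scale: "p (c *\<^sub>R x) = c * p x" if "0 < c" for c x
  proof (rule antisym[OF scale_le[OF that]])
    have "p (inverse c *\<^sub>R (c *\<^sub>R x)) \<le> inverse c * p (c *\<^sub>R x)" using that by (intro scale_le) simp
    then show "c * p x \<le> p (c *\<^sub>R x)" using that by (simp add: field_simps)
  qed
  have "p 0 = 0" using scale[of 2 0] by simp
  then have "p (c *\<^sub>R x) = c * p x" if "0 \<le> c" for c x
    using scale that by (cases "c = 0") auto
  then show ?thesis using subadditive by (simp add: sublinear_def)
qed

lemma sublinear_subadditive: "sublinear p \<Longrightarrow> p (x + y) \<le> p x + p y"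
  and sublinear_scaleR: "sublinear p \<Longrightarrow> 0 \<le> c \<Longrightarrow> p (c *\<^sub>R x) = c * p x"
  by (auto simp: sublinear_def)

lemma sublinear_zero: "sublinear p \<Longrightarrow> p 0 = 0"
  using sublinear_scaleR[of p 0] by simp

lemma sublinear_lower_bound: "sublinear p \<Longrightarrow> - p (- x) \<le> p x"
  using sublinear_subadditive[of p x "- x"] by (simp add: sublinear_zero)

lemma sublinear_norm: "sublinear norm"
  by (rule sublinearI) (simp_all add: norm_triangle_ineq)

lemma sublinear_INF:
  assumes nonempty: "I \<noteq> {}" and bdd: "\<And>x. bdd_below ((\<lambda>i. q i x) ` I)"
    and add: "\<And>i j x y. i \<in> I \<Longrightarrow> j \<in> I \<Longrightarrow> \<exists>k\<in>I. q k (x + y) \<le> q i x + q j y"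
    and scale: "\<And>i c x. i \<in> I \<Longrightarrow> 0 < c \<Longrightarrow> \<exists>k\<in>I. q k (c *\<^sub>R x) \<le> c * q i x"
  shows "sublinear (\<lambda>x. INF i\<in>I. q i x)" (is "sublinear ?q")
proof (rule sublinearI)
  have lower: "?q x \<le> q i x" if "i \<in> I" for i x by (rule cINF_lower[OF bdd that])
  fix x y
  have pairwise: "?q (x + y) \<le> q i x + q j y" if "i \<in> I" "j \<in> I" for i j
    using add[OF that] lower order_trans by blast
  have "?q (x + y) - q i x \<le> ?q y" if "i \<in> I" for i
    using pairwise[OF that] by (intro cINF_greatest[OF nonempty]) (simp add: diff_le_eq add.commute)
  then have "?q (x + y) - ?q y \<le> ?q x" by (intro cINF_greatest[OF nonempty]) (simp add: algebra_simps)
  then show "?q (x + y) \<le> ?q x + ?q y" by simp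
next
  fix c :: real and x assume "0 < c"
  have "?q (c *\<^sub>R x) \<le> c * q i x" if "i \<in> I" for i
    using scale[OF that \<open>0 < c\<close>] cINF_lower[OF bdd] order_trans by blast
  then have "?q (c *\<^sub>R x) / c \<le> ?q x"
    using \<open>0 < c\<close> by (intro cINF_greatest[OF nonempty]) (simp add: field_simps)
  then show "?q (c *\<^sub>R x) \<le> c * ?q x" using \<open>0 < c\<close> by (simp add: field_simps)
qed

lemma sublinear_INF_chain:
  assumes nonempty: "C \<noteq> {}" and sublinear: "\<And>q. q \<in> C \<Longrightarrow> sublinear q"
    and below: "\<And>q. q \<in> C \<Longrightarrow> q \<le> p"
    and chain: "\<And>q q'. q \<in> C \<Longrightarrow> q' \<in> C \<Longrightarrow> q \<le> q' \<or> q' \<le> q"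
  shows "sublinear (\<lambda>x. INF q\<in>C. q x)" and "\<And>q x. q \<in> C \<Longrightarrow> (INF q\<in>C. q x) \<le> q x"
proof -
  have bdd: "bdd_below ((\<lambda>q. q x) ` C)" for x
  proof (rule bdd_belowI2)
    fix q assume "q \<in> C"
    have "- p (- x) \<le> - q (- x)" using below[OF \<open>q \<in> C\<close>] by (simp add: le_fun_def)
    also have "\<dots> \<le> q x" by (rule sublinear_lower_bound[OF sublinear[OF \<open>q \<in> C\<close>]])
    finally show "- p (- x) \<le> q x" .
  qed
  show "\<And>q x. q \<in> C \<Longrightarrow> (INF q\<in>C. q x) \<le> q x" by (rule cINF_lower[OF bdd])
  show "sublinear (\<lambda>x. INF q\<in>C. q x)"
  proof (rule sublinear_INF[OF nonempty bdd])
    fix q q' x y assume members: "q \<in> C" "q' \<in> C"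
    then obtain m where smaller: "m \<in> C" "m \<le> q" "m \<le> q'" using chain[OF members] by (metis order_refl)
    have "m (x + y) \<le> m x + m y" by (rule sublinear_subadditive[OF sublinear[OF smaller(1)]])
    also have "\<dots> \<le> q x + q' y" using smaller(2,3) by (simp add: le_fun_def add_mono)
    finally show "\<exists>m\<in>C. m (x + y) \<le> q x + q' y" using smaller(1) by blast
  next
    fix q x and c :: real assume "q \<in> C" "0 < c"
    then show "\<exists>m\<in>C. m (c *\<^sub>R x) \<le> c * q x"
      using sublinear_scaleR[OF sublinear, of q c x] by (intro bexI[of _ q]) simp_all
  qed
qed

lemma exists_minimal_sublinear:
  fixes p :: "'a::real_vector \<Rightarrow> real"
  assumes "sublinear p"
  obtains q where "sublinear q" "q \<le> p" "\<And>q'. sublinear q' \<Longrightarrow> q' \<le> q \<Longrightarrow> q' = q"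
proof -
  define A where "A = {q. sublinear q \<and> q \<le> p}"
  have "\<exists>m\<in>A. \<forall>q\<in>A. q \<le> m \<longrightarrow> q = m"
  proof (rule predicate_Zorn[where P = "\<lambda>q q'. q' \<le> q"])
    show "partial_order_on A (relation_of (\<lambda>q q'. q' \<le> q) A)"
      by (auto simp: partial_order_on_def preorder_on_def relation_of_def refl_on_def trans_def
          antisym_def)
  next
    fix C assume "C \<in> Chains (relation_of (\<lambda>q q'. q' \<le> q) A)"
    then have "C \<subseteq> A" and chain: "\<And>q q'. q \<in> C \<Longrightarrow> q' \<in> C \<Longrightarrow> q \<le> q' \<or> q' \<le> q"
      by (auto simp: Chains_def relation_of_def)
    then have sublinear: "\<And>q. q \<in> C \<Longrightarrow> sublinear q" and below: "\<And>q. q \<in> C \<Longrightarrow> q \<le> p"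
      by (auto simp: A_def)
    show "\<exists>m\<in>A. \<forall>q\<in>C. m \<le> q"
    proof (cases "C = {}")
      case True
      then show ?thesis using assms by (auto simp: A_def)
    next
      case False
      then obtain q where "q \<in> C" by blast
      define m where "m x = (INF q\<in>C. q x)" for x
      have lower: "m \<le> q" if "q \<in> C" for q
        unfolding le_fun_def m_def
        using sublinear_INF_chain(2)[OF False sublinear below chain that] by blast
      have "sublinear m"
        unfolding m_def by (rule sublinear_INF_chain(1)[OF False sublinear below chain])
      moreover have "m \<le> p" using lower below \<open>q \<in> C\<close> order_trans by blast
      ultimately show ?thesis using lower by (auto simp: A_def)
    qed
  qed
  then obtain m where "m \<in> A" and minimal: "\<And>q. q \<in> A \<Longrightarrow> q \<le> m \<Longrightarrow> q = m" by blast
  then show ?thesis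
    by (intro that[of m]) (auto simp: A_def intro: order_trans)
qed

text \<open>The infimum of the difference quotients \<open>(p (a + e x) - p a) / e\<close> over \<open>e = 1 / t\<close>.\<close>

definition directional_deriv :: "('a::real_vector \<Rightarrow> real) \<Rightarrow> 'a \<Rightarrow> 'a \<Rightarrow> real" where
  "directional_deriv p a x = (INF t\<in>{0..}. p (x + t *\<^sub>R a) - t * p a)"

lemma directional_deriv_le:
  assumes "sublinear p" "0 \<le> t"
  shows "directional_deriv p a x \<le> p (x + t *\<^sub>R a) - t * p a"
  unfolding directional_deriv_def
proof (rule cINF_lower)
  show "bdd_below ((\<lambda>t. p (x + t *\<^sub>R a) - t * p a) ` {0..})"
  proof (rule bdd_belowI2)
    fix t :: real assume "t \<in> {0..}"
    then have "t * p a = p ((x + t *\<^sub>R a) + - x)" using sublinear_scaleR[OF assms(1), of t a] by simp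
    also have "\<dots> \<le> p (x + t *\<^sub>R a) + p (- x)" by (rule sublinear_subadditive[OF assms(1)])
    finally show "- p (- x) \<le> p (x + t *\<^sub>R a) - t * p a" by simp
  qed
qed (use assms(2) in simp)

lemma sublinear_directional_deriv:
  assumes "sublinear p"
  shows "sublinear (directional_deriv p a)"
  unfolding directional_deriv_def
proof (rule sublinear_INF)
  show "bdd_below ((\<lambda>t. p (x + t *\<^sub>R a) - t * p a) ` {0..})" for x
  proof (rule bdd_belowI2)
    fix t :: real assume "t \<in> {0..}"
    then show "directional_deriv p a x \<le> p (x + t *\<^sub>R a) - t * p a"
      by (intro directional_deriv_le[OF assms]) simp
  qed
next
  fix t t' :: real and x y assume "t \<in> {0..}" "t' \<in> {0..}"
  moreover have "p ((x + t *\<^sub>R a) + (y + t' *\<^sub>R a)) \<le> p (x + t *\<^sub>R a) + p (y + t' *\<^sub>R a)"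
    by (rule sublinear_subadditive[OF assms])
  then have "p ((x + y) + (t + t') *\<^sub>R a) - (t + t') * p a \<le>
      p (x + t *\<^sub>R a) - t * p a + (p (y + t' *\<^sub>R a) - t' * p a)"
    by (simp add: algebra_simps)
  ultimately show "\<exists>u\<in>{0..}. p ((x + y) + u *\<^sub>R a) - u * p a \<le>
      p (x + t *\<^sub>R a) - t * p a + (p (y + t' *\<^sub>R a) - t' * p a)"
    by (intro bexI[of _ "t + t'"]) auto
next
  fix t c :: real and x assume "t \<in> {0..}" "0 < c"
  moreover have "p (c *\<^sub>R (x + t *\<^sub>R a)) = c * p (x + t *\<^sub>R a)"
    using \<open>0 < c\<close> by (intro sublinear_scaleR[OF assms]) simp
  then have "p (c *\<^sub>R x + (c * t) *\<^sub>R a) - (c * t) * p a \<le> c * (p (x + t *\<^sub>R a) - t * p a)"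
    by (simp add: algebra_simps)
  ultimately show "\<exists>u\<in>{0..}. p (c *\<^sub>R x + u *\<^sub>R a) - u * p a \<le> c * (p (x + t *\<^sub>R a) - t * p a)"
    by (intro bexI[of _ "c * t"]) auto
qed simp

lemma minimal_sublinear_linear:
  assumes sublinear_q: "sublinear q" and minimal: "\<And>q'. sublinear q' \<Longrightarrow> q' \<le> q \<Longrightarrow> q' = q"
  shows "linear q"
proof -
  have add: "q (x + a) = q x + q a" for x a
  proof (rule antisym[OF sublinear_subadditive[OF sublinear_q]])
    have "directional_deriv q a \<le> q"
      using directional_deriv_le[OF sublinear_q order_refl, of a] by (simp add: le_fun_def)
    then have "directional_deriv q a = q"
      by (rule minimal[OF sublinear_directional_deriv[OF sublinear_q]])
    then show "q x + q a \<le> q (x + a)" using directional_deriv_le[OF sublinear_q, of 1 a x] by simp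
  qed
  have neg: "q (- x) = - q x" for x using add[of x "- x"] sublinear_zero[OF sublinear_q] by simp
  have "q (c *\<^sub>R x) = c * q x" for c x
  proof (cases "0 \<le> c")
    case False
    then have "q ((- c) *\<^sub>R x) = - c * q x" by (intro sublinear_scaleR[OF sublinear_q]) simp
    then show ?thesis using neg[of "c *\<^sub>R x"] by simp
  qed (rule sublinear_scaleR[OF sublinear_q])
  then show ?thesis using add by (intro linearI) simp_all
qed

theorem Hahn_Banach_sublinear:
  fixes p :: "'a::real_vector \<Rightarrow> real"
  assumes sublinear_p: "sublinear p"
  obtains f where "linear f" "\<And>x. f x \<le> p x" "f y = p y"
proof -
  obtain f where minimal_f: "sublinear f" "f \<le> directional_deriv p y"
      "\<And>q. sublinear q \<Longrightarrow> q \<le> f \<Longrightarrow> q = f"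
    by (rule exists_minimal_sublinear[OF sublinear_directional_deriv[OF sublinear_p, of y]]) blast
  have linear: "linear f" by (rule minimal_sublinear_linear[OF minimal_f(1,3)])
  have f_le: "f x \<le> p (x + t *\<^sub>R y) - t * p y" if "0 \<le> t" for x t
    using order_trans[OF le_funD[OF minimal_f(2)] directional_deriv_le[OF sublinear_p that]] .
  have below: "f x \<le> p x" for x using f_le[of 0 x] by simp
  have "- f y \<le> - p y"
    using f_le[of 1 "- y"] by (simp add: linear_neg[OF linear] sublinear_zero[OF sublinear_p])
  then show ?thesis using that[OF linear below] below[of y] by simp
qed

lemma exists_norming_functional:
  fixes y :: "'a::real_normed_vector"
  obtains \<rho> :: "'a \<Rightarrow> real" where "bounded_linear \<rho>" "\<And>x. \<bar>\<rho> x\<bar> \<le> norm x" "\<rho> y = norm y"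
proof -
  obtain \<rho> :: "'a \<Rightarrow> real" where dominated: "linear \<rho>" "\<And>x. \<rho> x \<le> norm x" "\<rho> y = norm y"
    using Hahn_Banach_sublinear[OF sublinear_norm] by blast
  have bound: "\<bar>\<rho> x\<bar> \<le> norm x" for x
    using dominated(2)[of x] dominated(2)[of "- x"]
    by (simp add: linear_neg[OF dominated(1)] abs_le_iff)
  have "bounded_linear \<rho>"
    using dominated(1) bound
    by (intro bounded_linear_intro[where K = 1]) (auto simp: linear_add linear_scale)
  then show ?thesis using that bound dominated(3) by blast
qed

lemma bounded_linear_if_bounded_on_ball:
  assumes linear: "linear L" and "0 < e" and bound: "\<And>x. norm x < e \<Longrightarrow> norm (L x) \<le> M"
  shows "bounded_linear L"
proof (rule bounded_linear_intro[where K = "2 * M / e"])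
  fix x
  show "norm (L x) \<le> norm x * (2 * M / e)"
  proof (cases "x = 0")
    case False
    define c where "c = e / (2 * norm x)"
    have "0 < c" "norm (c *\<^sub>R x) < e" using \<open>0 < e\<close> False by (simp_all add: c_def)
    then have "c * norm (L x) \<le> M" using bound[of "c *\<^sub>R x"] linear by (simp add: linear_scale)
    then have "norm (L x) \<le> M / c" using \<open>0 < c\<close> by (simp add: field_simps)
    then show ?thesis by (simp add: c_def field_simps)
  qed (use linear in \<open>simp add: linear_0\<close>)
qed (use linear in \<open>auto simp: linear_add linear_scale\<close>)

lemma bounded_linear_if_closed_sublevels:
  fixes L :: "'a::banach \<Rightarrow> 'b::real_normed_vector"
  assumes linear: "linear L" and closed: "\<And>n::nat. closed {x. norm (L x) \<le> n}"
  shows "bounded_linear L"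
proof -
  define V where "V n = {x. norm (L x) \<le> real n}" for n
  have cover: "\<Union>(range V) = UNIV" by (auto simp: V_def real_arch_simple)
  have "\<exists>n. interior (V n) \<noteq> {}"
  proof (rule ccontr)
    assume "\<not> ?thesis"
    then have "Met_TC.mtopology interior_of \<Union>(range V) = {}"
      using closed complete_UNIV by (intro Met_TC.metric_Baire_category_alt) (auto simp: V_def)
    then show False using cover by simp
  qed
  then obtain n a where "a \<in> interior (V n)" by blast
  then obtain e where "0 < e" and ball_subset: "ball a e \<subseteq> V n" by (auto simp: mem_interior)
  show ?thesis
  proof (rule bounded_linear_if_bounded_on_ball[OF linear \<open>0 < e\<close>])
    fix x :: 'a assume "norm x < e"
    then have "a + x \<in> V n" "a \<in> V n" using ball_subset \<open>0 < e\<close> by (auto simp: subset_iff dist_norm)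
    then have "norm (L (a + x)) \<le> n" "norm (L a) \<le> n" by (auto simp: V_def)
    moreover have "L x = L (a + x) - L a" using linear by (simp add: linear_add)
    ultimately show "norm (L x) \<le> 2 * real n" by (smt (verit) norm_triangle_ineq4)
  qed
qed

lemma bounded_linear_if_weakly_bounded:
  fixes L :: "'a::banach \<Rightarrow> 'b::real_normed_vector"
  assumes linear: "linear L"
    and weak: "\<And>\<rho> :: 'b \<Rightarrow> real. bounded_linear \<rho> \<Longrightarrow> bounded_linear (\<lambda>x. \<rho> (L x))"
  shows "bounded_linear L"
proof (rule bounded_linear_if_closed_sublevels[OF linear])
  fix n :: nat
  define G where "G = {\<rho> :: 'b \<Rightarrow> real. bounded_linear \<rho> \<and> (\<forall>y. \<bar>\<rho> y\<bar> \<le> norm y)}"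
  have "{x. norm (L x) \<le> n} = (\<Inter>\<rho>\<in>G. {x. \<rho> (L x) \<le> real n})"
  proof (intro equalityI subsetI)
    fix x assume "x \<in> {x. norm (L x) \<le> n}"
    then show "x \<in> (\<Inter>\<rho>\<in>G. {x. \<rho> (L x) \<le> real n})"
      unfolding G_def by (auto intro: order_trans[OF abs_ge_self order_trans])
  next
    fix x assume bounds: "x \<in> (\<Inter>\<rho>\<in>G. {x. \<rho> (L x) \<le> real n})"
    obtain \<rho> :: "'b \<Rightarrow> real" where "bounded_linear \<rho>" "\<And>y. \<bar>\<rho> y\<bar> \<le> norm y" "\<rho> (L x) = norm (L x)"
      by (rule exists_norming_functional[of "L x"]) blast
    then show "x \<in> {x. norm (L x) \<le> n}" using bounds by (auto simp: G_def)
  qed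
  then show "closed {x. norm (L x) \<le> n}"
    using weak
    by (auto simp: G_def intro!: closed_INT closed_Collect_le linear_continuous_on continuous_on_const)
qed

lemma norm_Blinfun_Re_le_onorm:
  assumes bounded_linear_f: "bounded_linear f"
  shows "norm (Blinfun (\<lambda>u. Re (f u))) \<le> onorm f"
proof -
  have "onorm (\<lambda>u. Re (f u)) \<le> onorm f"
  proof (rule onorm_bound[OF onorm_pos_le[OF bounded_linear_f]])
    show "norm (Re (f u)) \<le> onorm f * norm u" for u
      using order_trans[OF abs_Re_le_cmod onorm[OF bounded_linear_f]] by simp
  qed
  then show ?thesis
    by (simp add: norm_blinfun.rep_eq bounded_linear_Blinfun_apply
        bounded_linear_compose[OF bounded_linear_Re bounded_linear_f])
qed

section \<open>Functionals on a complex Banach space\<close>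

locale complex_banach =
  fixes smul :: "complex \<Rightarrow> 'a::banach \<Rightarrow> 'a"
  assumes complex_banach_scaling: "complex_banach_scaling smul"
begin

lemma smul_of_real: "smul (complex_of_real r) x = r *\<^sub>R x"
  using complex_banach_scaling unfolding complex_banach_scaling_def by blast

lemma norm_smul [simp]: "norm (smul c x) = norm c * norm x"
  using complex_banach_scaling unfolding complex_banach_scaling_def by blast

sublocale cv: vector_space smul
proof
  show "smul a (x + y) = smul a x + smul a y" "smul (a + b) x = smul a x + smul b x"
    "smul a (smul b x) = smul (a * b) x" for a b x y
    using complex_banach_scaling by (auto simp: complex_banach_scaling_def)
  show "smul 1 x = x" for x using smul_of_real[of 1 x] by simp
qed

lemma smul_Re_Im: "smul c x = Re c *\<^sub>R x + Im c *\<^sub>R smul \<i> x"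
proof -
  have "smul c x = smul (complex_of_real (Re c) + complex_of_real (Im c) * \<i>) x"
    by (rule arg_cong[where f = "\<lambda>c. smul c x"]) (simp add: complex_eq_iff)
  then show ?thesis by (simp only: cv.scale_left_distrib cv.scale_scale[symmetric] smul_of_real)
qed

lemma smul_scaleR: "smul c (r *\<^sub>R x) = r *\<^sub>R smul c x"
  using cv.scale_left_commute[of c "complex_of_real r" x] by (simp only: smul_of_real)

lemma bounded_linear_smul: "bounded_linear (smul c)"
  by (rule bounded_linear_intro[where K = "norm c"]) (simp_all add: cv.scale_right_distrib smul_scaleR)

abbreviation dual :: "('a \<Rightarrow> complex) set" where "dual \<equiv> cdual smul"

abbreviation bop :: "('a \<Rightarrow> 'a) \<Rightarrow> bool" where "bop \<equiv> bounded_clinear_op smul"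

lemma dualD:
  assumes "f \<in> dual"
  shows "bounded_linear f" "f (x + y) = f x + f y" "f (smul c x) = c * f x" "f 0 = 0"
    "f (x - y) = f x - f y" "f (- x) = - f x"
proof -
  show bounded_linear: "bounded_linear f" and "f (smul c x) = c * f x"
    using assms by (auto simp: cdual_def)
  show "f (x + y) = f x + f y" "f 0 = 0" "f (x - y) = f x - f y" "f (- x) = - f x"
    using bounded_linear by (auto simp: linear_simps)
qed

lemma dual_add [intro]: "f \<in> dual \<Longrightarrow> g \<in> dual \<Longrightarrow> (\<lambda>x. f x + g x) \<in> dual"
  by (auto simp: cdual_def bounded_linear_add algebra_simps)

lemma dual_diff [intro]: "f \<in> dual \<Longrightarrow> g \<in> dual \<Longrightarrow> (\<lambda>x. f x - g x) \<in> dual"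
  by (auto simp: cdual_def bounded_linear_sub algebra_simps)

lemma dual_scale [intro]: "f \<in> dual \<Longrightarrow> (\<lambda>x. c * f x) \<in> dual"
  by (auto simp: cdual_def bounded_linear_const_mult algebra_simps)

lemma dual_zero [simp]: "(\<lambda>x. 0) \<in> dual"
  by (simp add: cdual_def)

lemma dual_comp: "f \<in> dual \<Longrightarrow> bop T \<Longrightarrow> (\<lambda>x. f (T x)) \<in> dual"
  by (auto simp: cdual_def bounded_clinear_op_def bounded_linear_compose)

lemma bopD:
  assumes "bop T"
  shows "bounded_linear T" "T (x + y) = T x + T y" "T (smul c x) = smul c (T x)" "T 0 = 0"
    "T (x - y) = T x - T y" "T (- x) = - T x"
proof -
  show bounded_linear: "bounded_linear T" and "T (smul c x) = smul c (T x)"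
    using assms by (auto simp: bounded_clinear_op_def)
  show "T (x + y) = T x + T y" "T 0 = 0" "T (x - y) = T x - T y" "T (- x) = - T x"
    using bounded_linear by (auto simp: linear_simps)
qed

lemma bop_add [intro]: "bop S \<Longrightarrow> bop T \<Longrightarrow> bop (\<lambda>x. S x + T x)"
  by (auto simp: bounded_clinear_op_def bounded_linear_add cv.scale_right_distrib)

lemma bop_scale [intro]: "bop T \<Longrightarrow> bop (\<lambda>x. smul c (T x))"
  using bounded_linear_compose[OF bounded_linear_smul]
  by (auto simp: bounded_clinear_op_def mult.commute)

lemma bop_comp [intro]: "bop S \<Longrightarrow> bop T \<Longrightarrow> bop (S \<circ> T)"
  by (auto simp: bounded_clinear_op_def comp_def bounded_linear_compose)

lemma bop_id: "bop id"
  by (simp add: bounded_clinear_op_def id_def bounded_linear_ident)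

lemma bop_funpow [intro]: "bop T \<Longrightarrow> bop (T ^^ j)"
  by (induction j) (simp_all only: funpow.simps bop_id bop_comp)

definition complexify :: "('a \<Rightarrow> real) \<Rightarrow> 'a \<Rightarrow> complex" where
  "complexify \<rho> u = Complex (\<rho> u) (- \<rho> (smul \<i> u))"

lemma Re_complexify [simp]: "Re (complexify \<rho> u) = \<rho> u"
  by (simp add: complexify_def)

lemma complexify_Re:
  assumes "f \<in> dual"
  shows "complexify (\<lambda>u. Re (f u)) = f"
  using assms by (auto simp: complexify_def dualD complex_eq_iff)

lemma complexify_in_dual:
  assumes bounded_linear_\<rho>: "bounded_linear \<rho>"
  shows "complexify \<rho> \<in> dual"
proof -
  note lin = linear_simps[OF bounded_linear_\<rho>]
  obtain K where bound: "\<And>x. norm (\<rho> x) \<le> norm x * K"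
    using bounded_linear.bounded[OF bounded_linear_\<rho>] by blast
  have "bounded_linear (complexify \<rho>)"
  proof (rule bounded_linear_intro[where K = "2 * K"])
    fix u
    have "cmod (complexify \<rho> u) \<le> \<bar>\<rho> u\<bar> + \<bar>\<rho> (smul \<i> u)\<bar>"
      using cmod_le[of "complexify \<rho> u"] by (simp add: complexify_def)
    then show "cmod (complexify \<rho> u) \<le> norm u * (2 * K)"
      using bound[of u] bound[of "smul \<i> u"] by simp
  qed (auto simp: complexify_def lin cv.scale_right_distrib smul_scaleR complex_eq_iff)
  moreover have "complexify \<rho> (smul c u) = c * complexify \<rho> u" for c u
  proof -
    have "\<rho> (smul d u) = Re d * \<rho> u + Im d * \<rho> (smul \<i> u)" for d
      by (subst smul_Re_Im) (simp add: lin)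
    from this[of c] this[of "\<i> * c"] show ?thesis by (simp add: complexify_def complex_eq_iff)
  qed
  ultimately show ?thesis by (simp add: cdual_def)
qed

lemma exists_dual:
  assumes "y \<noteq> 0" obtains f where "f \<in> dual" "f y = 1"
proof -
  obtain \<rho> :: "'a \<Rightarrow> real" where norming: "bounded_linear \<rho>" "\<rho> y = norm y"
    by (rule exists_norming_functional[of y]) blast
  have "Re (complexify \<rho> y) \<noteq> 0" using norming(2) assms by simp
  then have "complexify \<rho> y \<noteq> 0" by fastforce
  then show ?thesis
    by (intro that[of "\<lambda>x. (1 / complexify \<rho> y) * complexify \<rho> x"] dual_scale complexify_in_dual
        norming(1)) simp
qed

lemma dual_separates: "(\<And>f. f \<in> dual \<Longrightarrow> f x = f y) \<Longrightarrow> x = y"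
  using exists_dual[of "x - y"] by (metis dualD(5) eq_iff_diff_eq_0 zero_neq_one)

lemma exists_dual_nonzero_on_both:
  assumes "y \<noteq> 0" "w \<noteq> 0" obtains f where "f \<in> dual" "f y = 1" "f w \<noteq> 0"
proof -
  obtain f where f_dual: "f \<in> dual" "f y = 1" using exists_dual[OF assms(1)] by blast
  obtain g where g_dual: "g \<in> dual" "g w = 1" using exists_dual[OF assms(2)] by blast
  consider (f_nonzero) "f w \<noteq> 0" | (complementary) "f w = 0" "g y = 0" | (g_nonzero) "g y \<noteq> 0" by blast
  then show ?thesis
  proof cases
    case f_nonzero then show ?thesis using that f_dual by blast
  next
    case complementary then show ?thesis using f_dual g_dual by (intro that[of "\<lambda>x. f x + g x"]) auto
  next
    case g_nonzero then show ?thesis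
      using g_dual by (intro that[of "\<lambda>x. (1 / g y) * g x"] dual_scale) auto
  qed
qed

lemma exists_biorthogonal_pair:
  assumes "a \<noteq> 0" "\<And>t. c \<noteq> smul t a"
  obtains \<alpha> \<gamma> where "\<alpha> \<in> dual" "\<gamma> \<in> dual" "\<alpha> a = 1" "\<alpha> c = 0" "\<gamma> a = 0" "\<gamma> c = 1"
proof -
  obtain \<alpha> where \<alpha>_dual: "\<alpha> \<in> dual" "\<alpha> a = 1" using exists_dual[OF assms(1)] by blast
  have "c - smul (\<alpha> c) a \<noteq> 0" using assms(2)[of "\<alpha> c"] by simp
  then obtain \<beta> where \<beta>_dual: "\<beta> \<in> dual" "\<beta> (c - smul (\<alpha> c) a) = 1" using exists_dual by blast
  define \<gamma> where "\<gamma> = (\<lambda>x. \<beta> x - \<beta> a * \<alpha> x)"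
  have "\<gamma> \<in> dual" unfolding \<gamma>_def using \<alpha>_dual(1) \<beta>_dual(1) by (intro dual_diff dual_scale)
  moreover have "\<gamma> a = 0" "\<gamma> c = 1" using \<alpha>_dual \<beta>_dual by (simp_all add: \<gamma>_def dualD algebra_simps)
  ultimately show ?thesis
    using \<alpha>_dual by (intro that[of "\<lambda>x. \<alpha> x - \<alpha> c * \<gamma> x" \<gamma>] dual_diff dual_scale) auto
qed

lemma bop_if_weakly_bounded:
  assumes add: "\<And>x y. S (x + y) = S x + S y" and scale: "\<And>c x. S (smul c x) = smul c (S x)"
    and weak: "\<And>h. h \<in> dual \<Longrightarrow> (\<lambda>x. h (S x)) \<in> dual"
  shows "bop S"
proof -
  have "linear S"
    using add scale[of "complex_of_real _"] by (intro linearI) (simp_all add: smul_of_real)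
  then have "bounded_linear S"
  proof (rule bounded_linear_if_weakly_bounded)
    fix \<rho> :: "'a \<Rightarrow> real" assume "bounded_linear \<rho>"
    then have "bounded_linear (\<lambda>x. complexify \<rho> (S x))"
      using weak[OF complexify_in_dual] by (simp add: cdual_def)
    then have "bounded_linear (\<lambda>x. Re (complexify \<rho> (S x)))"
      by (rule bounded_linear_compose[OF bounded_linear_Re])
    then show "bounded_linear (\<lambda>x. \<rho> (S x))" by simp
  qed
  then show ?thesis using scale by (simp add: bounded_clinear_op_def)
qed

lemma complexify_blinfun_in_dual: "complexify (blinfun_apply \<rho>) \<in> dual"
  by (rule complexify_in_dual) (rule blinfun.bounded_linear_right)

lemma linear_comp_complexify:
  assumes add: "\<And>f g. f \<in> dual \<Longrightarrow> g \<in> dual \<Longrightarrow> S (\<lambda>u. f u + g u) = S f + S g"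
    and scale: "\<And>c f. f \<in> dual \<Longrightarrow> S (\<lambda>u. c * f u) = smul c (S f)"
  shows "linear (\<lambda>\<rho> :: 'a \<Rightarrow>\<^sub>L real. S (complexify (blinfun_apply \<rho>)))"
proof (rule linearI)
  fix \<rho> \<sigma> :: "'a \<Rightarrow>\<^sub>L real" and t :: real
  have "complexify (\<rho> + \<sigma>) = (\<lambda>u. complexify \<rho> u + complexify \<sigma> u)"
    by (auto simp: complexify_def blinfun.add_left complex_eq_iff)
  then show "S (complexify (\<rho> + \<sigma>)) = S (complexify \<rho>) + S (complexify \<sigma>)"
    using add[OF complexify_blinfun_in_dual complexify_blinfun_in_dual] by simp
  have "complexify (t *\<^sub>R \<rho>) = (\<lambda>u. complex_of_real t * complexify \<rho> u)"
    by (auto simp: complexify_def blinfun.scaleR_left complex_eq_iff)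
  then show "S (complexify (t *\<^sub>R \<rho>)) = t *\<^sub>R S (complexify \<rho>)"
    using scale[OF complexify_blinfun_in_dual] by (simp add: smul_of_real)
qed

lemma dual_map_bounded_if_weak_star_continuous:
  assumes add: "\<And>f g. f \<in> dual \<Longrightarrow> g \<in> dual \<Longrightarrow> S (\<lambda>u. f u + g u) = S f + S g"
    and scale: "\<And>c f. f \<in> dual \<Longrightarrow> S (\<lambda>u. c * f u) = smul c (S f)"
    and weak: "\<And>h. h \<in> dual \<Longrightarrow> \<exists>c u. \<forall>f\<in>dual. h (S f) = c * f u"
  shows "\<exists>K. \<forall>f\<in>dual. norm (S f) \<le> K * onorm f"
proof -
  define L where "L \<rho> = S (complexify (blinfun_apply \<rho>))" for \<rho> :: "'a \<Rightarrow>\<^sub>L real"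
  have "linear L" unfolding L_def by (rule linear_comp_complexify[OF add scale])
  then have "bounded_linear L"
  proof (rule bounded_linear_if_weakly_bounded)
    fix \<sigma> :: "'a \<Rightarrow> real" assume "bounded_linear \<sigma>"
    then obtain c u where weak_\<sigma>: "\<And>f. f \<in> dual \<Longrightarrow> complexify \<sigma> (S f) = c * f u"
      using weak[OF complexify_in_dual] by blast
    have "\<sigma> (L \<rho>) = Re c * \<rho> u + Im c * \<rho> (smul \<i> u)" for \<rho>
      using arg_cong[OF weak_\<sigma>[OF complexify_blinfun_in_dual[of \<rho>]], of Re] by (simp add: L_def complexify_def)
    then show "bounded_linear (\<lambda>\<rho>. \<sigma> (L \<rho>))"
      by (simp add: bounded_linear_add bounded_linear_const_mult blinfun.bounded_linear_left)
  qed
  then obtain K where bound: "0 < K" "\<And>\<rho>. norm (L \<rho>) \<le> norm \<rho> * K"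
    using bounded_linear.pos_bounded by blast
  have "norm (S f) \<le> K * onorm f" if f_dual: "f \<in> dual" for f
  proof -
    define \<rho> where "\<rho> = Blinfun (\<lambda>u. Re (f u))"
    have "blinfun_apply \<rho> = (\<lambda>u. Re (f u))"
      unfolding \<rho>_def
      by (intro bounded_linear_Blinfun_apply
          bounded_linear_compose[OF bounded_linear_Re dualD(1)[OF f_dual]])
    then have "L \<rho> = S f" by (simp add: L_def complexify_Re[OF f_dual])
    then have "norm (S f) \<le> norm \<rho> * K" using bound(2)[of \<rho>] by simp
    also have "\<dots> \<le> onorm f * K"
      unfolding \<rho>_def
      using bound(1) by (intro mult_right_mono norm_Blinfun_Re_le_onorm dualD(1)[OF f_dual]) simp
    finally show ?thesis by (simp add: mult.commute)
  qed
  then show ?thesis by blast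
qed

section \<open>Rank one operators and their trace\<close>

abbreviation (input) op_add :: "('a \<Rightarrow> 'a) \<Rightarrow> ('a \<Rightarrow> 'a) \<Rightarrow> 'a \<Rightarrow> 'a" (infixl "\<boxplus>" 52) where
  "S \<boxplus> T \<equiv> (\<lambda>u. S u + T u)"

abbreviation (input) op_scale :: "complex \<Rightarrow> ('a \<Rightarrow> 'a) \<Rightarrow> 'a \<Rightarrow> 'a" (infixr "\<boxdot>" 54) where
  "c \<boxdot> T \<equiv> (\<lambda>u. smul c (T u))"

lemma op_add_cancel: "S \<boxplus> T = S \<boxplus> T' \<Longrightarrow> T = T'"
  by (simp add: fun_eq_iff)

lemma op_double_cancel: "S \<boxplus> S = T \<boxplus> T \<Longrightarrow> S = T"
  by (simp add: fun_eq_iff scaleR_2[symmetric])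

definition tensor :: "'a \<Rightarrow> ('a \<Rightarrow> complex) \<Rightarrow> 'a \<Rightarrow> 'a" (infix "\<odot>" 80) where
  "x \<odot> f = (\<lambda>u. smul (f u) x)"

lemma tensor_apply: "(x \<odot> f) u = smul (f u) x"
  by (simp add: tensor_def)

lemma tensor_add_left: "(x + y) \<odot> f = x \<odot> f \<boxplus> y \<odot> f"
  by (simp add: tensor_def cv.scale_right_distrib)

lemma tensor_add_right: "x \<odot> (\<lambda>u. f u + g u) = x \<odot> f \<boxplus> x \<odot> g"
  by (simp add: tensor_def cv.scale_left_distrib)

lemma tensor_scale_left: "smul c x \<odot> f = c \<boxdot> x \<odot> f"
  by (simp add: tensor_def mult.commute)

lemma tensor_scale_right: "x \<odot> (\<lambda>u. c * f u) = c \<boxdot> x \<odot> f"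
  by (simp add: tensor_def)

lemma bop_tensor [intro]:
  assumes f_dual: "f \<in> dual"
  shows "bop (x \<odot> f)"
proof -
  obtain K where bound: "\<And>u. norm (f u) \<le> norm u * K"
    using bounded_linear.bounded[OF dualD(1)[OF f_dual]] by blast
  have "bounded_linear (x \<odot> f)"
  proof (rule bounded_linear_intro[where K = "K * norm x"])
    fix u r
    show "norm ((x \<odot> f) u) \<le> norm u * (K * norm x)"
      using mult_right_mono[OF bound[of u] norm_ge_zero[of x]] by (simp add: tensor_apply mult.assoc)
    have "f (r *\<^sub>R u) = complex_of_real r * f u"
      using dualD(3)[OF f_dual, of "complex_of_real r" u] by (simp add: smul_of_real)
    then show "(x \<odot> f) (r *\<^sub>R u) = r *\<^sub>R (x \<odot> f) u"
      by (simp add: tensor_apply smul_of_real[symmetric])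
  qed (simp add: tensor_apply dualD[OF f_dual] cv.scale_left_distrib)
  then show ?thesis by (simp add: bounded_clinear_op_def tensor_def dualD[OF f_dual])
qed

lemma comp_tensor: "bop T \<Longrightarrow> T \<circ> x \<odot> f = T x \<odot> f"
  by (simp add: tensor_def fun_eq_iff bopD)

lemma tensor_comp: "x \<odot> f \<circ> T = x \<odot> (\<lambda>u. f (T u))"
  by (simp add: tensor_def fun_eq_iff)

text \<open>The zero operator counts as an operator of rank one.\<close>

definition rank_one :: "('a \<Rightarrow> 'a) \<Rightarrow> bool" where
  "rank_one T \<longleftrightarrow> (\<exists>x f. f \<in> dual \<and> T = x \<odot> f)"

lemma rank_one_tensor [simp]: "f \<in> dual \<Longrightarrow> rank_one (x \<odot> f)"
  by (auto simp: rank_one_def)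

lemma rank_oneE:
  assumes "rank_one T" obtains x f where "f \<in> dual" "T = x \<odot> f"
  using assms by (auto simp: rank_one_def)

lemma bop_rank_one: "rank_one T \<Longrightarrow> bop T"
  by (auto elim: rank_oneE)

lemma rank_one_zero: "rank_one (\<lambda>_. 0)"
  using rank_one_tensor[OF dual_zero, of 0] by (simp add: tensor_def)

lemma rank_one_scale: "rank_one T \<Longrightarrow> rank_one (c \<boxdot> T)"
  by (elim rank_oneE) (simp flip: tensor_scale_left)

lemma rank_one_comp_left: "rank_one R \<Longrightarrow> bop T \<Longrightarrow> rank_one (T \<circ> R)"
  by (elim rank_oneE) (simp add: comp_tensor)

lemma rank_one_comp_right: "rank_one R \<Longrightarrow> bop T \<Longrightarrow> rank_one (R \<circ> T)"
  by (elim rank_oneE) (simp add: tensor_comp dual_comp)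

lemma rank_le_rank_one:
  assumes "rank_one R"
  shows "rank_le smul R 1"
proof -
  obtain x f where "R = x \<odot> f" using assms by (rule rank_oneE)
  then have "R u \<in> cspan_list smul [x]" for u
    by (auto simp: cspan_list_def tensor_apply intro!: exI[of _ "\<lambda>_. f u"])
  then show ?thesis unfolding rank_le_def by (intro exI[of _ "[x]"]) auto
qed

lemma rank_le_add:
  assumes "rank_le smul S m" "rank_le smul T n"
  shows "rank_le smul (S \<boxplus> T) (m + n)"
proof -
  obtain vs ws where range_S: "length vs \<le> m" "range S \<subseteq> cspan_list smul vs"
    and range_T: "length ws \<le> n" "range T \<subseteq> cspan_list smul ws"
    using assms unfolding rank_le_def by blast
  have "S u + T u \<in> cspan_list smul (vs @ ws)" for u
  proof -
    obtain c d where S_u: "S u = (\<Sum>i<length vs. smul (c i) (vs ! i))"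
      and T_u: "T u = (\<Sum>i<length ws. smul (d i) (ws ! i))"
      using range_S(2) range_T(2) unfolding cspan_list_def by blast
    define e where "e i = (if i < length vs then c i else d (i - length vs))" for i
    let ?summand = "\<lambda>i. smul (e i) ((vs @ ws) ! i)"
    have "S u + T u = (\<Sum>i<length vs. ?summand i) + (\<Sum>i<length ws. ?summand (length vs + i))"
      by (simp add: S_u T_u e_def nth_append)
    also have "\<dots> = (\<Sum>i<length (vs @ ws). ?summand i)"
      using sum.atLeastLessThan_concat[of 0 "length vs" "length vs + length ws" ?summand]
        sum.shift_bounds_nat_ivl[of ?summand 0 "length vs" "length ws"]
      by (simp add: atLeast0LessThan add.commute)
    finally show ?thesis unfolding cspan_list_def by blast
  qed
  then show ?thesis unfolding rank_le_def
    using range_S(1) range_T(1) by (intro exI[of _ "vs @ ws"]) auto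
qed

lemma rank_one_minor_zero:
  assumes "rank_one T" "f \<in> dual" "g \<in> dual"
  shows "f (T u) * g (T v) = f (T v) * g (T u)"
  using assms by (elim rank_oneE) (simp add: tensor_apply dualD)

definition coord :: "'a \<Rightarrow> 'a \<Rightarrow> complex" where
  "coord = cv.representation (cv.extend_basis {})"

text \<open>The diagonal sum in a Hamel basis; \<open>Sum_any\<close> is 0 if infinitely many terms are nonzero.\<close>

definition tr :: "('a \<Rightarrow> 'a) \<Rightarrow> complex" where
  "tr T = Sum_any (\<lambda>b. coord (T b) b)"

lemma independent_hamel_basis: "cv.independent (cv.extend_basis {})"
  and span_hamel_basis: "cv.span (cv.extend_basis {}) = UNIV"
  by (simp_all add: cv.independent_extend_basis cv.span_extend_basis cv.independent_empty)

lemma coord_add: "coord (x + y) b = coord x b + coord y b"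
  and coord_scale: "coord (smul c x) b = c * coord x b"
  by (simp_all add: coord_def cv.representation_add cv.representation_scale
      independent_hamel_basis span_hamel_basis)

lemma finite_coord: "finite {b. coord x b \<noteq> 0}"
  unfolding coord_def by (rule cv.finite_representation)

lemma coord_expansion: "(\<Sum>b | coord x b \<noteq> 0. smul (coord x b) b) = x"
  unfolding coord_def using independent_hamel_basis span_hamel_basis
  by (simp add: cv.sum_nonzero_representation_eq)

lemma finite_diagonal_rank_one:
  assumes "rank_one T" shows "finite {b. coord (T b) b \<noteq> 0}"
proof -
  obtain x f where "T = x \<odot> f" using assms by (rule rank_oneE)
  then show ?thesis
    by (intro finite_subset[OF _ finite_coord[of x]]) (auto simp: tensor_apply coord_scale)
qed

lemma tr_tensor [simp]:
  assumes f_dual: "f \<in> dual" shows "tr (x \<odot> f) = f x"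
proof -
  have "tr (x \<odot> f) = Sum_any (\<lambda>b. f b * coord x b)" by (simp add: tr_def tensor_apply coord_scale)
  also have "\<dots> = (\<Sum>b | coord x b \<noteq> 0. f b * coord x b)"
    by (intro Sum_any.expand_superset[OF finite_coord]) auto
  also have "\<dots> = f (\<Sum>b | coord x b \<noteq> 0. smul (coord x b) b)"
    by (simp add: linear_sum[OF bounded_linear.linear[OF dualD(1)[OF f_dual]]] dualD(3)[OF f_dual]
        mult.commute)
  finally show ?thesis by (simp only: coord_expansion)
qed

lemma tr_add: "rank_one R \<Longrightarrow> rank_one S \<Longrightarrow> tr (R \<boxplus> S) = tr R + tr S"
  by (simp add: tr_def coord_add Sum_any.distrib finite_diagonal_rank_one)

lemma tr_scale: "rank_one R \<Longrightarrow> tr (c \<boxdot> R) = c * tr R"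
  by (simp add: tr_def coord_scale Sum_any_right_distrib finite_diagonal_rank_one)

lemma tr_zero [simp]: "tr (\<lambda>_. 0) = 0"
  using tr_scale[OF rank_one_zero, of 0] by simp

lemma tr_comp_tensor: "bop T \<Longrightarrow> f \<in> dual \<Longrightarrow> tr (T \<circ> x \<odot> f) = f (T x)"
  by (simp add: comp_tensor)

lemma tr_tensor_comp: "bop T \<Longrightarrow> f \<in> dual \<Longrightarrow> tr (x \<odot> f \<circ> T) = f (T x)"
  by (simp add: tensor_comp dual_comp)

lemma tr_comp_commute: "rank_one R \<Longrightarrow> bop T \<Longrightarrow> tr (T \<circ> R) = tr (R \<circ> T)"
  by (elim rank_oneE) (simp add: tr_comp_tensor tr_tensor_comp)

lemma comp_op_add: "bop T \<Longrightarrow> T \<circ> (R \<boxplus> S) = T \<circ> R \<boxplus> T \<circ> S"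
  by (simp add: fun_eq_iff bopD)

lemma comp_op_scale: "bop T \<Longrightarrow> T \<circ> (c \<boxdot> R) = c \<boxdot> T \<circ> R"
  by (simp add: fun_eq_iff bopD)

lemma tr_comp_add:
  assumes "bop T" "bop R" "bop S" "rank_one T \<or> (rank_one R \<and> rank_one S)"
  shows "tr (T \<circ> (R \<boxplus> S)) = tr (T \<circ> R) + tr (T \<circ> S)"
  unfolding comp_op_add[OF assms(1)]
  using assms(2-4) rank_one_comp_left[OF _ assms(1)] rank_one_comp_right by (blast intro: tr_add)

lemma tr_add_comp:
  assumes "rank_one R" "rank_one S" "bop T"
  shows "tr ((R \<boxplus> S) \<circ> T) = tr (R \<circ> T) + tr (S \<circ> T)"
proof -
  have "(R \<boxplus> S) \<circ> T = (R \<circ> T) \<boxplus> (S \<circ> T)" by (simp add: comp_def)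
  then show ?thesis using assms by (simp only: tr_add rank_one_comp_right)
qed

lemma tr_comp_scale:
  assumes "bop T" "bop R" "rank_one T \<or> rank_one R"
  shows "tr (T \<circ> (c \<boxdot> R)) = c * tr (T \<circ> R)"
  unfolding comp_op_scale[OF assms(1)]
  using assms(2,3) rank_one_comp_left[OF _ assms(1)] rank_one_comp_right by (blast intro: tr_scale)

lemma rank_one_sandwich:
  assumes "rank_one R" and bop_T: "bop T"
  shows "R \<circ> T \<circ> R = tr (R \<circ> T) \<boxdot> R"
proof -
  obtain x f where "f \<in> dual" "R = x \<odot> f" using assms(1) by (rule rank_oneE)
  then show ?thesis
    using bop_T
    by (simp add: tr_tensor_comp) (simp add: fun_eq_iff tensor_apply bopD dualD mult.commute)
qed

lemma rank_one_square: "rank_one R \<Longrightarrow> R \<circ> R = tr R \<boxdot> R"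
  using rank_one_sandwich[of R id] by (simp add: bop_id)

lemma rank_one_funpow: "rank_one R \<Longrightarrow> R ^^ Suc j = tr R ^ j \<boxdot> R"
proof (induction j)
  case (Suc j)
  then have "R ^^ Suc (Suc j) = R \<circ> (tr R ^ j \<boxdot> R)" by (simp only: funpow.simps(2)[of "Suc j"])
  also have "\<dots> = tr R ^ Suc j \<boxdot> R"
    using Suc.prems by (simp add: comp_op_scale bop_rank_one rank_one_square mult.commute)
  finally show ?case .
qed simp

lemma tr_funpow: "rank_one R \<Longrightarrow> tr (R ^^ Suc j) = tr R ^ Suc j"
  by (simp only: rank_one_funpow tr_scale power_Suc mult.commute)

lemma tr_rank_one_funpow_comp:
  "rank_one R \<Longrightarrow> bop T \<Longrightarrow> tr (R ^^ Suc j \<circ> T) = tr R ^ j * tr (R \<circ> T)"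
  by (simp add: rank_one_funpow comp_def tr_scale rank_one_comp_right[unfolded comp_def]
      del: funpow.simps)

lemma rank_one_trace_shift:
  assumes "rank_one R" "tr R = 0" "R \<noteq> (\<lambda>_. 0)"
  obtains S where "rank_one S" "\<And>c. rank_one (S \<boxplus> c \<boxdot> R)" "\<And>c. tr (S \<boxplus> c \<boxdot> R) \<noteq> 0"
proof -
  obtain x f where f_dual: "f \<in> dual" and R_tensor: "R = x \<odot> f" using assms(1) by (rule rank_oneE)
  obtain u where f_u_nonzero: "f u \<noteq> 0" using assms(3) by (force simp: R_tensor tensor_def fun_eq_iff)
  have shift: "u \<odot> f \<boxplus> c \<boxdot> R = (u + smul c x) \<odot> f" for c
    by (simp add: R_tensor tensor_add_left tensor_scale_left)
  show ?thesis
    using assms(2) f_u_nonzero f_dual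
    by (intro that[of "u \<odot> f"]) (simp_all add: shift dualD, simp add: R_tensor)
qed

lemma bop_eqI_tr:
  assumes "bop S" "bop T" and tr_eq: "\<And>R. rank_one R \<Longrightarrow> tr R = 1 \<Longrightarrow> tr (R \<circ> S) = tr (R \<circ> T)"
  shows "S = T"
proof (rule ext, rule ccontr)
  fix y assume "S y \<noteq> T y"
  moreover from this have "y \<noteq> 0" using assms(1,2) by (auto simp: bopD)
  ultimately obtain g where g_separates: "g \<in> dual" "g y = 1" "g (S y - T y) \<noteq> 0"
    using exists_dual_nonzero_on_both[of y "S y - T y"] by auto
  then have "g (S y) = g (T y)"
    using tr_eq[of "y \<odot> g"] assms(1,2) by (simp add: tr_tensor_comp)
  then show False using g_separates by (simp add: dualD)
qed

lemma tensor_add_dichotomy: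
  assumes a_nonzero: "a \<noteq> 0" and b_nonzero: "b \<in> dual" "b p \<noteq> 0" and d_dual: "d \<in> dual"
    and rank_one_add: "rank_one (a \<odot> b \<boxplus> c \<odot> d)"
  shows "(\<exists>t. c = smul t a) \<or> (\<exists>t. d = (\<lambda>u. t * b u))"
proof (cases "\<exists>t. c = smul t a")
  case False
  then obtain \<alpha> \<gamma> where \<alpha>_dual: "\<alpha> \<in> dual" "\<alpha> a = 1" "\<alpha> c = 0"
    and \<gamma>_dual: "\<gamma> \<in> dual" "\<gamma> a = 0" "\<gamma> c = 1"
    using exists_biorthogonal_pair[OF a_nonzero, of c] by metis
  have "b p * d u = b u * d p" for u
    using rank_one_minor_zero[OF rank_one_add \<alpha>_dual(1) \<gamma>_dual(1), of p u] \<alpha>_dual \<gamma>_dual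
    by (simp add: tensor_apply dualD)
  then have "d = (\<lambda>u. (d p / b p) * b u)" using b_nonzero(2) by (simp add: fun_eq_iff field_simps)
  then show ?thesis by blast
qed blast

lemma rank_one_pencil:
  assumes "rank_one R" "rank_one S" "rank_one (R \<boxplus> S)"
  shows "rank_one (c \<boxdot> R \<boxplus> S)"
proof (cases "\<forall>u. R u = 0")
  case True
  then show ?thesis using assms(2) by simp
next
  case False
  obtain a b where R_tensor: "b \<in> dual" "R = a \<odot> b" using assms(1) by (rule rank_oneE)
  obtain p q where S_tensor: "q \<in> dual" "S = p \<odot> q" using assms(2) by (rule rank_oneE)
  obtain u where "a \<noteq> 0" "b u \<noteq> 0" using False R_tensor(2) by (auto simp: tensor_apply)
  then have "(\<exists>t. p = smul t a) \<or> (\<exists>t. q = (\<lambda>u. t * b u))"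
    using tensor_add_dichotomy R_tensor S_tensor assms(3) by blast
  then show ?thesis
  proof (elim disjE exE)
    fix t assume "p = smul t a"
    then have "c \<boxdot> R \<boxplus> S = a \<odot> (\<lambda>u. c * b u + t * q u)"
      by (simp add: R_tensor S_tensor tensor_def fun_eq_iff cv.scale_left_distrib mult.commute)
    then show ?thesis using R_tensor(1) S_tensor(1) by (simp add: dual_add dual_scale)
  next
    fix t assume "q = (\<lambda>u. t * b u)"
    then have "c \<boxdot> R \<boxplus> S = (smul c a + smul t p) \<odot> b"
      by (simp add: R_tensor S_tensor tensor_def fun_eq_iff cv.scale_right_distrib mult.commute)
    then show ?thesis using R_tensor(1) by simp
  qed
qed

lemma rank_one_direction:
  assumes "rank_one R" "rank_one (R \<boxplus> T)" "rank_one (R \<boxplus> 2 \<boxdot> T)"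
  shows "rank_one T"
proof -
  have "smul 2 v = v + v" for v using cv.scale_left_distrib[of 1 1 v] by simp
  then have "2 \<boxdot> (R \<boxplus> T) \<boxplus> (- 1) \<boxdot> R = R \<boxplus> 2 \<boxdot> T" by (simp add: fun_eq_iff)
  then have "rank_one (2 \<boxdot> (R \<boxplus> T) \<boxplus> (- 1) \<boxdot> R)" using assms(3) by simp
  then have "rank_one ((1 / 2) \<boxdot> 2 \<boxdot> (R \<boxplus> T) \<boxplus> (- 1) \<boxdot> R)"
    by (rule rank_one_pencil[OF rank_one_scale[OF assms(2)] rank_one_scale[OF assms(1)]])
  then show ?thesis by simp
qed

lemma rank_one_factor_dichotomy:
  assumes idempotent_P: "rank_one P" "tr P = 1" and "rank_one R" "rank_one (P \<boxplus> R)"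
  shows "R \<circ> P = R \<or> P \<circ> R = R"
proof -
  obtain y g where P_tensor: "g \<in> dual" "P = y \<odot> g" using idempotent_P(1) by (rule rank_oneE)
  obtain p q where R_tensor: "q \<in> dual" "R = p \<odot> q" using assms(3) by (rule rank_oneE)
  have g_y: "g y = 1" using idempotent_P(2) P_tensor by simp
  then have "y \<noteq> 0" using dualD(4)[OF P_tensor(1)] by auto
  then have "(\<exists>t. p = smul t y) \<or> (\<exists>t. q = (\<lambda>u. t * g u))"
    using tensor_add_dichotomy[of y g y q p] P_tensor R_tensor g_y assms(4) by simp
  then show ?thesis
    using P_tensor(1) g_y
    by (auto simp: P_tensor(2) R_tensor(2) fun_eq_iff tensor_apply dualD mult.commute)
qed

lemma rank_one_additive_family:
  assumes idempotent_P: "P \<in> \<R>" "tr P = 1" and rank_one: "\<And>R. R \<in> \<R> \<Longrightarrow> rank_one R"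
    and add: "\<And>R S. R \<in> \<R> \<Longrightarrow> S \<in> \<R> \<Longrightarrow> R \<boxplus> S \<in> \<R>"
  shows "(\<forall>R\<in>\<R>. R \<circ> P = R) \<or> (\<forall>R\<in>\<R>. P \<circ> R = R)"
proof (rule ccontr)
  have factor: "R \<circ> P = R \<or> P \<circ> R = R" if "R \<in> \<R>" for R
    using that idempotent_P add rank_one by (intro rank_one_factor_dichotomy) blast+
  assume "\<not> ?thesis"
  then obtain R S where R_not_right: "R \<in> \<R>" "R \<circ> P \<noteq> R" and S_not_left: "S \<in> \<R>" "P \<circ> S \<noteq> S" by blast
  then have "P \<circ> R = R" "S \<circ> P = S" using factor by blast+
  moreover have "(R \<boxplus> S) \<circ> P = R \<boxplus> S \<or> P \<circ> (R \<boxplus> S) = R \<boxplus> S"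
    using factor[OF add] R_not_right(1) S_not_left(1) by blast
  moreover have "(R \<boxplus> S) \<circ> P = (R \<circ> P) \<boxplus> (S \<circ> P)" by (simp add: comp_def)
  moreover have "P \<circ> (R \<boxplus> S) = P \<circ> R \<boxplus> P \<circ> S"
    by (intro comp_op_add bop_rank_one rank_one idempotent_P(1))
  ultimately show False using R_not_right(2) S_not_left(2) by (auto simp: fun_eq_iff)
qed

lemma tr_comp_if_common_factor:
  assumes idempotent_P: "rank_one P" "tr P = 1" and "bop A" "bop B"
    and common: "A \<circ> P = A \<and> B \<circ> P = B \<or> P \<circ> A = A \<and> P \<circ> B = B"
  shows "tr (A \<circ> B) = tr A * tr B"
proof -
  obtain y g where P_tensor: "g \<in> dual" "P = y \<odot> g" using idempotent_P(1) by (rule rank_oneE)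
  from common show ?thesis
  proof (elim disjE conjE)
    assume "A \<circ> P = A" "B \<circ> P = B"
    then have A_tensor: "A y \<odot> g = A" and B_tensor: "B y \<odot> g = B"
      using comp_tensor[OF \<open>bop A\<close>, of y g] comp_tensor[OF \<open>bop B\<close>, of y g]
      by (simp_all add: P_tensor(2))
    have "tr (A \<circ> B y \<odot> g) = g (smul (g (B y)) (A y))"
      using fun_cong[OF A_tensor, of "B y"] \<open>bop A\<close> P_tensor(1)
      by (simp add: tr_comp_tensor tensor_apply)
    moreover have "tr (A y \<odot> g) = g (A y)" "tr (B y \<odot> g) = g (B y)" using P_tensor(1) by simp_all
    ultimately show ?thesis using P_tensor(1) by (simp add: A_tensor B_tensor dualD)
  next
    assume "P \<circ> A = A" "P \<circ> B = B"
    then have A_tensor: "y \<odot> (\<lambda>u. g (A u)) = A" and B_tensor: "y \<odot> (\<lambda>u. g (B u)) = B"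
      by (simp_all add: P_tensor(2) tensor_comp)
    note g_comp = dual_comp[OF P_tensor(1) \<open>bop A\<close>] dual_comp[OF P_tensor(1) \<open>bop B\<close>]
    have "tr (y \<odot> (\<lambda>u. g (A u)) \<circ> B) = g (A (smul (g (B y)) y))"
      using fun_cong[OF B_tensor, of y] \<open>bop B\<close> g_comp(1) by (simp add: tr_tensor_comp tensor_apply)
    moreover have "tr (y \<odot> (\<lambda>u. g (A u))) = g (A y)" "tr (y \<odot> (\<lambda>u. g (B u))) = g (B y)"
      using g_comp by simp_all
    ultimately show ?thesis using \<open>bop A\<close> P_tensor(1) by (simp add: A_tensor B_tensor bopD dualD)
  qed
qed

lemma tr_comp_cross:
  assumes rank_one_P: "rank_one P" and rank_one_X: "rank_one X" and "bop A" "bop B"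
    and A_factor: "A \<circ> P = A" and B_factor: "P \<circ> B = B"
  shows "tr (A \<circ> B \<circ> X) * tr (P \<circ> X) = tr (A \<circ> X) * tr (B \<circ> X)"
proof -
  obtain y g where P_tensor: "g \<in> dual" "P = y \<odot> g" using rank_one_P by (rule rank_oneE)
  obtain a b where X_tensor: "b \<in> dual" "X = a \<odot> b" using rank_one_X by (rule rank_oneE)
  have A_apply: "A u = smul (g u) (A y)" for u
    using fun_cong[OF A_factor, of u] \<open>bop A\<close> by (simp add: P_tensor(2) tensor_apply bopD)
  have B_apply: "B u = smul (g (B u)) y" for u
    using fun_cong[OF B_factor, of u] by (simp add: P_tensor(2) tensor_apply)
  have "tr (A \<circ> B \<circ> X) = g (B a) * b (A y)"
    using A_apply[of "B a"] X_tensor \<open>bop A\<close> \<open>bop B\<close> by (simp add: tr_comp_tensor bop_comp dualD)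
  moreover have "tr (P \<circ> X) = g a * b y"
    using X_tensor P_tensor by (simp add: tr_comp_tensor bop_tensor tensor_apply dualD)
  moreover have "tr (A \<circ> X) = g a * b (A y)"
    using A_apply[of a] X_tensor \<open>bop A\<close> by (simp add: tr_comp_tensor dualD)
  moreover have "tr (B \<circ> X) = g (B a) * b y"
    using B_apply[of a] X_tensor \<open>bop B\<close> by (metis tr_comp_tensor dualD(3))
  ultimately show ?thesis by simp
qed

lemma biadditive_zero_if_generically_zero:
  fixes q :: "'a \<Rightarrow> ('a \<Rightarrow> complex) \<Rightarrow> complex"
  assumes f0_normalized: "f0 \<in> dual" "f0 x0 = 1"
    and add_left: "\<And>u v h. h \<in> dual \<Longrightarrow> q (u + v) h = q u h + q v h"
    and add_right: "\<And>u h k. h \<in> dual \<Longrightarrow> k \<in> dual \<Longrightarrow> q u (\<lambda>v. h v + k v) = q u h + q u k"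
    and generic: "\<And>u h. h \<in> dual \<Longrightarrow> f0 u \<noteq> 0 \<Longrightarrow> h x0 \<noteq> 0 \<Longrightarrow> q u h = 0"
    and h_dual: "h \<in> dual"
  shows "q u h = 0"
proof -
  have generic_functional: "q u h = 0" if h_dual: "h \<in> dual" and "h x0 \<noteq> 0" for u h
  proof (cases "f0 u = 0")
    case True
    then have "f0 (u + x0) \<noteq> 0" using f0_normalized by (simp add: dualD)
    then have "q (u + x0) h = 0" "q x0 h = 0"
      using generic[OF h_dual] f0_normalized(2) that(2) by simp_all
    then show ?thesis using add_left[OF h_dual, of u x0] by simp
  qed (use generic that in blast)
  show ?thesis
  proof (cases "h x0 = 0")
    case True
    then have "q u (\<lambda>v. h v + f0 v) = 0" "q u f0 = 0"
      using generic_functional[OF dual_add[OF h_dual f0_normalized(1)]]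
        generic_functional[OF f0_normalized(1)] f0_normalized(2) by simp_all
    then show ?thesis using add_right[OF h_dual f0_normalized(1), of u] by simp
  qed (rule generic_functional[OF h_dual])
qed

lemma rank_one_functional_proportional_to_tr:
  assumes add: "\<And>R S. rank_one R \<Longrightarrow> rank_one S \<Longrightarrow> rank_one (R \<boxplus> S) \<Longrightarrow> \<tau> (R \<boxplus> S) = \<tau> R + \<tau> S"
    and scale: "\<And>c R. rank_one R \<Longrightarrow> \<tau> (c \<boxdot> R) = c * \<tau> R"
    and trace_zero: "\<And>R. rank_one R \<Longrightarrow> tr R = 0 \<Longrightarrow> \<tau> R = 0"
    and idempotent_P: "rank_one P" "tr P = 1" and rank_one_R: "rank_one R"
  shows "\<tau> R = \<tau> P * tr R"
proof -
  have add_left: "\<tau> ((x + y) \<odot> f) = \<tau> (x \<odot> f) + \<tau> (y \<odot> f)" if "f \<in> dual" for x y f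
    using add[of "x \<odot> f" "y \<odot> f"] that by (simp flip: tensor_add_left)
  have add_right: "\<tau> (x \<odot> (\<lambda>u. f u + h u)) = \<tau> (x \<odot> f) + \<tau> (x \<odot> h)" if "f \<in> dual" "h \<in> dual" for x f h
    using add[of "x \<odot> f" "x \<odot> h"] that by (simp add: dual_add flip: tensor_add_right)
  have scale_left: "\<tau> (smul c x \<odot> f) = c * \<tau> (x \<odot> f)" if "f \<in> dual" for c x f
    using scale[of "x \<odot> f" c] that by (simp flip: tensor_scale_left)
  have vanish: "\<tau> (x \<odot> f) = 0" if "f \<in> dual" "f x = 0" for x f
    using trace_zero[of "x \<odot> f"] that by simp
  obtain y g where P_tensor: "g \<in> dual" "P = y \<odot> g" using idempotent_P(1) by (rule rank_oneE)
  have g_y: "g y = 1" using idempotent_P(2) P_tensor by simp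
  have column: "\<tau> (x \<odot> g) = \<tau> P * g x" for x
  proof -
    have "\<tau> (x \<odot> g) = \<tau> (smul (g x) y \<odot> g) + \<tau> ((x - smul (g x) y) \<odot> g)"
      using add_left[OF P_tensor(1), of "smul (g x) y" "x - smul (g x) y"] by simp
    also have "\<tau> ((x - smul (g x) y) \<odot> g) = 0"
      using P_tensor(1) g_y by (intro vanish) (simp_all add: dualD)
    finally show ?thesis by (simp add: scale_left[OF P_tensor(1)] P_tensor(2))
  qed
  have generic: "\<tau> (x \<odot> f) = \<tau> P * f x" if f_dual: "f \<in> dual" and g_x_nonzero: "g x \<noteq> 0" for x f
  proof -
    define c where "c = f x / g x"
    have "\<tau> (x \<odot> f) = \<tau> (x \<odot> (\<lambda>u. c * g u)) + \<tau> (x \<odot> (\<lambda>u. f u - c * g u))"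
      using add_right[OF dual_scale[OF P_tensor(1)] dual_diff[OF f_dual dual_scale[OF P_tensor(1)]],
          of x c c] by simp
    also have "\<tau> (x \<odot> (\<lambda>u. f u - c * g u)) = 0"
      using g_x_nonzero by (intro vanish dual_diff dual_scale f_dual P_tensor(1)) (simp add: c_def)
    also have "x \<odot> (\<lambda>u. c * g u) = smul c x \<odot> g" by (simp add: tensor_scale_left tensor_scale_right)
    finally show ?thesis
      using g_x_nonzero by (simp add: column dualD(3)[OF P_tensor(1)]) (simp add: c_def)
  qed
  obtain x f where f_dual: "f \<in> dual" "R = x \<odot> f" using rank_one_R by (rule rank_oneE)
  define q where "q u h = \<tau> (u \<odot> h) - \<tau> P * h u" for u h
  have "q x f = 0"
    by (rule biadditive_zero_if_generically_zero[OF P_tensor(1) g_y _ _ _ f_dual(1)])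
      (simp_all add: q_def add_left add_right generic dualD algebra_simps)
  then show ?thesis using f_dual by (simp add: q_def)
qed

end

section \<open>Jordan automorphisms\<close>

locale standard_algebra = complex_banach smul
  for smul :: "complex \<Rightarrow> 'a::banach \<Rightarrow> 'a" +
  fixes \<A> :: "('a \<Rightarrow> 'a) set"
  assumes standard: "standard_operator_algebra smul \<A>"
begin

lemma algebra_bop: "T \<in> \<A> \<Longrightarrow> bop T"
  and algebra_add: "S \<in> \<A> \<Longrightarrow> T \<in> \<A> \<Longrightarrow> S \<boxplus> T \<in> \<A>"
  and algebra_comp: "S \<in> \<A> \<Longrightarrow> T \<in> \<A> \<Longrightarrow> S \<circ> T \<in> \<A>"
  and algebra_scale: "T \<in> \<A> \<Longrightarrow> c \<boxdot> T \<in> \<A>"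
  using standard by (simp_all add: standard_operator_algebra_def)

lemma algebra_rank_one:
  assumes "rank_one R"
  shows "R \<in> \<A>"
proof -
  have "R \<in> {T. bop T \<and> finite_rank smul T}"
    using bop_rank_one[OF assms] rank_le_rank_one[OF assms] unfolding finite_rank_def by blast
  then show ?thesis
    using standard unfolding standard_operator_algebra_def by (elim conjE) (rule subsetD)
qed

abbreviation jordan :: "(('a \<Rightarrow> 'a) \<Rightarrow> 'a \<Rightarrow> 'a) \<Rightarrow> bool" where
  "jordan \<equiv> jordan_automorphism smul \<A>"

lemma jordan_bij: "jordan \<theta> \<Longrightarrow> bij_betw \<theta> \<A> \<A>"
  and jordan_add: "jordan \<theta> \<Longrightarrow> S \<in> \<A> \<Longrightarrow> T \<in> \<A> \<Longrightarrow> \<theta> (S \<boxplus> T) = \<theta> S \<boxplus> \<theta> T"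
  and jordan_scale: "jordan \<theta> \<Longrightarrow> T \<in> \<A> \<Longrightarrow> \<theta> (c \<boxdot> T) = c \<boxdot> \<theta> T"
  and jordan_anticommutator: "jordan \<theta> \<Longrightarrow> S \<in> \<A> \<Longrightarrow> T \<in> \<A> \<Longrightarrow>
    \<theta> (S \<circ> T \<boxplus> T \<circ> S) = \<theta> S \<circ> \<theta> T \<boxplus> \<theta> T \<circ> \<theta> S"
  by (simp_all add: jordan_automorphism_def alg_linear_bij_def)

lemma jordan_in_algebra: "jordan \<theta> \<Longrightarrow> T \<in> \<A> \<Longrightarrow> \<theta> T \<in> \<A>"
  using bij_betwE[OF jordan_bij, of \<theta>] by simp

lemma algebra_automorphism_jordan:
  assumes "algebra_automorphism smul \<A> \<theta>" shows "jordan \<theta>"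
  unfolding jordan_automorphism_def
proof (intro conjI ballI)
  show linear: "alg_linear_bij smul \<A> \<theta>" using assms by (simp add: algebra_automorphism_def)
  fix S T assume algebra: "S \<in> \<A>" "T \<in> \<A>"
  have "\<theta> (S \<circ> T \<boxplus> T \<circ> S) = \<theta> (S \<circ> T) \<boxplus> \<theta> (T \<circ> S)"
    using linear algebra_comp algebra unfolding alg_linear_bij_def by blast
  moreover have "\<theta> (S \<circ> T) = \<theta> S \<circ> \<theta> T" "\<theta> (T \<circ> S) = \<theta> T \<circ> \<theta> S"
    using assms algebra by (auto simp: algebra_automorphism_def)
  ultimately show "\<theta> (\<lambda>x. S (T x) + T (S x)) = (\<lambda>x. \<theta> S (\<theta> T x) + \<theta> T (\<theta> S x))"
    by simp
qed

lemma jordan_square: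
  assumes jordan_\<theta>: "jordan \<theta>" and S_algebra: "S \<in> \<A>"
  shows "\<theta> (S \<circ> S) = \<theta> S \<circ> \<theta> S"
proof (rule op_double_cancel)
  have "S \<circ> S \<in> \<A>" by (rule algebra_comp[OF S_algebra S_algebra])
  then show "\<theta> (S \<circ> S) \<boxplus> \<theta> (S \<circ> S) = \<theta> S \<circ> \<theta> S \<boxplus> \<theta> S \<circ> \<theta> S"
    by (simp only: jordan_add[OF jordan_\<theta>, symmetric]
        jordan_anticommutator[OF jordan_\<theta> S_algebra S_algebra])
qed

text \<open>With \<open>K = A B + B A\<close> one has \<open>2 A B A = (A K + K A) - (A\<^sup>2 B + B A\<^sup>2)\<close>.\<close>

lemma jordan_triple:
  assumes jordan_\<theta>: "jordan \<theta>" and A_algebra: "A \<in> \<A>" and B_algebra: "B \<in> \<A>"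
  shows "\<theta> (A \<circ> B \<circ> A) = \<theta> A \<circ> \<theta> B \<circ> \<theta> A"
proof -
  let ?anti = "\<lambda>S T. S \<circ> T \<boxplus> T \<circ> S"
  have anti: "?anti S T \<in> \<A>" "\<theta> (?anti S T) = ?anti (\<theta> S) (\<theta> T)" if "S \<in> \<A>" "T \<in> \<A>" for S T
    using algebra_add algebra_comp that jordan_anticommutator[OF jordan_\<theta> that] by (blast, blast)
  have expand: "?anti S (?anti S T) = ?anti (S \<circ> S) T \<boxplus> (S \<circ> T \<circ> S \<boxplus> S \<circ> T \<circ> S)" if "bop S" for S T
    using that by (simp add: fun_eq_iff bopD algebra_simps)
  have ABA_algebra: "A \<circ> B \<circ> A \<in> \<A>" and AA_algebra: "A \<circ> A \<in> \<A>"
    using A_algebra B_algebra algebra_comp by blast+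
  have "?anti (\<theta> A) (?anti (\<theta> A) (\<theta> B)) = \<theta> (?anti A (?anti A B))"
    by (simp only: anti A_algebra B_algebra)
  also have "\<dots> = \<theta> (?anti (A \<circ> A) B) \<boxplus> (\<theta> (A \<circ> B \<circ> A) \<boxplus> \<theta> (A \<circ> B \<circ> A))"
    unfolding expand[OF algebra_bop[OF A_algebra]]
    by (simp only: jordan_add[OF jordan_\<theta>] anti(1)[OF AA_algebra B_algebra] ABA_algebra algebra_add)
  also have "\<theta> (?anti (A \<circ> A) B) = ?anti (\<theta> A \<circ> \<theta> A) (\<theta> B)"
    by (simp only: anti(2)[OF AA_algebra B_algebra] jordan_square[OF jordan_\<theta> A_algebra])
  finally have "?anti (\<theta> A \<circ> \<theta> A) (\<theta> B) \<boxplus> (\<theta> A \<circ> \<theta> B \<circ> \<theta> A \<boxplus> \<theta> A \<circ> \<theta> B \<circ> \<theta> A) =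
      ?anti (\<theta> A \<circ> \<theta> A) (\<theta> B) \<boxplus> (\<theta> (A \<circ> B \<circ> A) \<boxplus> \<theta> (A \<circ> B \<circ> A))"
    unfolding expand[OF algebra_bop[OF jordan_in_algebra[OF jordan_\<theta> A_algebra]]] .
  from op_double_cancel[OF op_add_cancel[OF this]] show ?thesis ..
qed

lemma rank_one_if_tensor_sandwich_scalar:
  assumes bop_T: "bop T" and sandwich: "\<And>R. rank_one R \<Longrightarrow> \<exists>c. T \<circ> R \<circ> T = c \<boxdot> T"
  shows "rank_one T"
proof (cases "\<forall>u. T u = 0")
  case True
  then show ?thesis using rank_one_zero by (metis ext)
next
  case False
  then obtain z where "T z \<noteq> 0" by blast
  then obtain h where h_normalized: "h \<in> dual" "h (T z) = 1" by (rule exists_dual)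
  have "T u = (T z \<odot> (\<lambda>u. h (T u))) u" for u
  proof -
    obtain c where "T \<circ> u \<odot> h \<circ> T = c \<boxdot> T"
      using sandwich[OF rank_one_tensor[OF h_normalized(1)]] by blast
    then have T_u: "T u = smul c (T z)"
      using h_normalized(2) by (auto dest!: fun_cong[where x = z] simp: tensor_apply)
    then have "h (T u) = c" using h_normalized by (simp add: dualD(3)[OF h_normalized(1)])
    then show ?thesis using T_u by (simp add: tensor_apply)
  qed
  then have "T = T z \<odot> (\<lambda>u. h (T u))" by (rule ext)
  then show ?thesis unfolding rank_one_def using dual_comp[OF h_normalized(1) bop_T] by blast
qed

lemma jordan_rank_one:
  assumes jordan_\<theta>: "jordan \<theta>" and rank_one_R: "rank_one R"
  shows "rank_one (\<theta> R)"
proof (rule rank_one_if_tensor_sandwich_scalar)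
  have R_algebra: "R \<in> \<A>" by (rule algebra_rank_one[OF rank_one_R])
  then show "bop (\<theta> R)" using jordan_in_algebra[OF jordan_\<theta>] algebra_bop by blast
  fix S assume "rank_one S"
  then obtain A where preimage: "A \<in> \<A>" "\<theta> A = S"
    using algebra_rank_one bij_betw_imp_surj_on[OF jordan_bij[OF jordan_\<theta>]] by (metis imageE)
  have "\<theta> R \<circ> S \<circ> \<theta> R = \<theta> (tr (R \<circ> A) \<boxdot> R)"
    using jordan_triple[OF jordan_\<theta> R_algebra preimage(1)]
      rank_one_sandwich[OF rank_one_R algebra_bop[OF preimage(1)]] preimage(2) by simp
  then show "\<exists>c. \<theta> R \<circ> S \<circ> \<theta> R = c \<boxdot> \<theta> R" using jordan_scale[OF jordan_\<theta> R_algebra] by auto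
qed

lemma jordan_tr:
  assumes jordan_\<theta>: "jordan \<theta>" and rank_one_R: "rank_one R"
  shows "tr (\<theta> R) = tr R"
proof (cases "\<theta> R = (\<lambda>_. 0)")
  case True
  have R_algebra: "R \<in> \<A>" by (rule algebra_rank_one[OF rank_one_R])
  have "\<theta> (0 \<boxdot> R) = \<theta> R" using jordan_scale[OF jordan_\<theta> R_algebra, of 0] True by simp
  then have "0 \<boxdot> R = R"
    using bij_betw_imp_inj_on[OF jordan_bij[OF jordan_\<theta>]] algebra_scale[OF R_algebra, of 0] R_algebra
    by (blast dest: inj_onD)
  then have "tr R = tr (\<lambda>_. 0)" by simp
  then show ?thesis using True by simp
next
  case False
  have R_algebra: "R \<in> \<A>" by (rule algebra_rank_one[OF rank_one_R])
  obtain u where "\<theta> R u \<noteq> 0" using False by blast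
  have "tr (\<theta> R) \<boxdot> \<theta> R = \<theta> (R \<circ> R)"
    using jordan_square[OF jordan_\<theta> R_algebra]
      rank_one_square[OF jordan_rank_one[OF jordan_\<theta> rank_one_R]] by simp
  also have "\<dots> = tr R \<boxdot> \<theta> R"
    using rank_one_square[OF rank_one_R] jordan_scale[OF jordan_\<theta> R_algebra] by simp
  finally show ?thesis using \<open>\<theta> R u \<noteq> 0\<close> by (metis cv.scale_right_imp_eq)
qed

end

section \<open>Maps preserving the trace form\<close>

locale power_trace_map = standard_algebra smul \<A>
  for smul :: "complex \<Rightarrow> 'a::banach \<Rightarrow> 'a" and \<A> +
  fixes \<phi> :: "('a \<Rightarrow> 'a) \<Rightarrow> 'a \<Rightarrow> 'a" and n :: nat
  assumes maps: "A \<in> \<A> \<Longrightarrow> \<phi> A \<in> \<A>"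
    and rank_two_in_range: "rank_one R \<Longrightarrow> rank_one S \<Longrightarrow> R \<boxplus> S \<in> \<phi> ` \<A>"
    and tr_power: "A \<in> \<A> \<Longrightarrow> B \<in> \<A> \<Longrightarrow> rank_one A \<or> rank_one B \<Longrightarrow> rank_one (\<phi> A) \<or> rank_one (\<phi> B) \<Longrightarrow>
      tr (\<phi> A ^^ Suc n \<circ> \<phi> B) = tr (A ^^ Suc n \<circ> B)"
begin

lemma image_bop: "A \<in> \<A> \<Longrightarrow> bop (\<phi> A)"
  by (intro algebra_bop maps)

lemma rank_one_preimage:
  assumes "rank_one R" obtains C where "C \<in> \<A>" "\<phi> C = R"
  using rank_two_in_range[OF assms rank_one_zero] by auto

lemma tr_comp_image:
  assumes C_algebra: "C \<in> \<A>" and idempotent_image: "rank_one (\<phi> C)" "tr (\<phi> C) = 1"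
    and rank_one_R: "rank_one R"
  shows "tr (\<phi> C \<circ> \<phi> R) = tr (C ^^ Suc n \<circ> R)"
  using tr_power[OF C_algebra algebra_rank_one[OF rank_one_R]] rank_one_R idempotent_image
  by (simp only: rank_one_funpow) simp

lemma image_scale:
  assumes rank_one_R: "rank_one R"
  shows "\<phi> (c \<boxdot> R) = c \<boxdot> \<phi> R"
proof (rule bop_eqI_tr)
  note cR = rank_one_scale[OF rank_one_R, of c]
  show "bop (\<phi> (c \<boxdot> R))" "bop (c \<boxdot> \<phi> R)"
    using image_bop algebra_rank_one rank_one_R cR by blast+
  fix Q assume idempotent_Q: "rank_one Q" "tr Q = 1"
  then obtain C where preimage: "C \<in> \<A>" "\<phi> C = Q" using rank_one_preimage by metis
  note transfer = tr_comp_image[OF preimage(1), unfolded preimage(2), OF idempotent_Q]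
  have "tr (Q \<circ> \<phi> (c \<boxdot> R)) = tr (C ^^ Suc n \<circ> (c \<boxdot> R))" by (rule transfer[OF cR])
  also have "\<dots> = c * tr (C ^^ Suc n \<circ> R)"
    using rank_one_R by (intro tr_comp_scale bop_funpow algebra_bop preimage(1) bop_rank_one) simp_all
  also have "\<dots> = tr (Q \<circ> (c \<boxdot> \<phi> R))"
    using idempotent_Q(1) image_bop[OF algebra_rank_one[OF rank_one_R]]
    by (simp add: transfer[OF rank_one_R, symmetric] tr_comp_scale bop_rank_one del: funpow.simps)
  finally show "tr (Q \<circ> \<phi> (c \<boxdot> R)) = tr (Q \<circ> (c \<boxdot> \<phi> R))" .
qed

lemma image_add:
  assumes rank_one_R: "rank_one R" and rank_one_S: "rank_one S" and rank_one_sum: "rank_one (R \<boxplus> S)"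
  shows "\<phi> (R \<boxplus> S) = \<phi> R \<boxplus> \<phi> S"
proof (rule bop_eqI_tr)
  have bop: "bop (\<phi> R)" "bop (\<phi> S)" using image_bop algebra_rank_one rank_one_R rank_one_S by blast+
  then show "bop (\<phi> (R \<boxplus> S))" "bop (\<phi> R \<boxplus> \<phi> S)"
    using image_bop[OF algebra_rank_one[OF rank_one_sum]] by blast+
  fix Q assume idempotent_Q: "rank_one Q" "tr Q = 1"
  then obtain C where preimage: "C \<in> \<A>" "\<phi> C = Q" using rank_one_preimage by metis
  note transfer = tr_comp_image[OF preimage(1), unfolded preimage(2), OF idempotent_Q]
  have "tr (Q \<circ> \<phi> (R \<boxplus> S)) = tr (C ^^ Suc n \<circ> (R \<boxplus> S))" by (rule transfer[OF rank_one_sum])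
  also have "\<dots> = tr (C ^^ Suc n \<circ> R) + tr (C ^^ Suc n \<circ> S)"
    using rank_one_R rank_one_S
    by (intro tr_comp_add bop_funpow algebra_bop preimage(1) bop_rank_one) simp_all
  also have "\<dots> = tr (Q \<circ> (\<phi> R \<boxplus> \<phi> S))"
    using idempotent_Q(1) bop
    by (simp add: transfer[OF rank_one_R, symmetric] transfer[OF rank_one_S, symmetric] tr_comp_add
        bop_rank_one del: funpow.simps)
  finally show "tr (Q \<circ> \<phi> (R \<boxplus> S)) = tr (Q \<circ> (\<phi> R \<boxplus> \<phi> S))" .
qed

lemma image_zero: "\<phi> (\<lambda>_. 0) = (\<lambda>_. 0)"
  using image_scale[OF rank_one_zero, of 0] by simp

end

locale trace_form_preserver = power_trace_map smul \<A> \<psi> 0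
  for smul :: "complex \<Rightarrow> 'a::banach \<Rightarrow> 'a" and \<A> and \<psi> +
  assumes rank_one_image: "rank_one R \<Longrightarrow> rank_one (\<psi> R)"
    and tr_image: "rank_one R \<Longrightarrow> tr (\<psi> R) = tr R"
begin

lemma tr_form: "rank_one R \<Longrightarrow> A \<in> \<A> \<Longrightarrow> tr (\<psi> R \<circ> \<psi> A) = tr (R \<circ> A)"
  using tr_power[OF algebra_rank_one] rank_one_image by simp

lemma tr_form_tensor:
  "f \<in> dual \<Longrightarrow> g \<in> dual \<Longrightarrow> tr (\<psi> (x \<odot> f) \<circ> \<psi> (y \<odot> g)) = f y * g x"
  by (simp add: tr_form algebra_rank_one tr_tensor_comp bop_tensor tensor_apply dualD mult.commute)

lemma rank_one_eqI:
  assumes rank_one_R: "rank_one R" and rank_one_S: "rank_one S"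
    and tr_eq: "\<And>X. rank_one X \<Longrightarrow> tr (\<psi> X \<circ> R) = tr (\<psi> X \<circ> S)"
  shows "R = S"
proof -
  obtain C where preimage: "R \<boxplus> (- 1) \<boxdot> S = \<psi> C" "C \<in> \<A>"
    using rank_two_in_range[OF rank_one_R rank_one_scale[OF rank_one_S]] by (rule imageE)
  have "C = (\<lambda>_. 0)"
  proof (rule bop_eqI_tr[OF algebra_bop[OF preimage(2)] bop_rank_one[OF rank_one_zero]])
    fix X assume rank_one_X: "rank_one X"
    have "tr (X \<circ> C) = tr (\<psi> X \<circ> (R \<boxplus> (- 1) \<boxdot> S))"
      using tr_form[OF rank_one_X preimage(2)] by (simp only: preimage(1))
    also have "\<dots> = tr (\<psi> X \<circ> R) + tr (\<psi> X \<circ> ((- 1) \<boxdot> S))"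
      using rank_one_R rank_one_scale[OF rank_one_S]
      by (intro tr_comp_add bop_rank_one rank_one_image[OF rank_one_X] disjI2 conjI)
    also have "tr (\<psi> X \<circ> ((- 1) \<boxdot> S)) = - 1 * tr (\<psi> X \<circ> S)"
      using rank_one_S by (intro tr_comp_scale bop_rank_one rank_one_image[OF rank_one_X] disjI2)
    also have "tr (\<psi> X \<circ> R) + - 1 * tr (\<psi> X \<circ> S) = 0" by (simp add: tr_eq[OF rank_one_X])
    also have "0 = tr (X \<circ> (\<lambda>_. 0))"
      using bopD(4)[OF bop_rank_one[OF rank_one_X]] by (simp add: comp_def)
    finally show "tr (X \<circ> C) = tr (X \<circ> (\<lambda>_. 0))" .
  qed
  then have "\<psi> C = (\<lambda>_. 0)" by (simp add: image_zero)
  then show ?thesis using preimage(1) by (simp add: fun_eq_iff)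
qed

context
  fixes x0 :: 'a and f0 :: "'a \<Rightarrow> complex"
  assumes f0_normalized: "f0 \<in> dual" "f0 x0 = 1"
begin

abbreviation (input) "base_image \<equiv> \<psi> (x0 \<odot> f0)"
abbreviation (input) "col_image x \<equiv> \<psi> (x \<odot> f0)"
abbreviation (input) "row_image f \<equiv> \<psi> (x0 \<odot> f)"

text \<open>Dividing by the trace of \<open>base_image \<circ> X\<close> determines that of \<open>G \<circ> X\<close> for generic X, hence for all X by
  bilinearity.\<close>

lemma image_tensor_eqI:
  assumes f_dual: "f \<in> dual" and rank_one_G: "rank_one G"
    and cross: "\<And>X. rank_one X \<Longrightarrow>
        tr (G \<circ> X) * tr (base_image \<circ> X) = tr (col_image x \<circ> X) * tr (row_image f \<circ> X)"
  shows "\<psi> (x \<odot> f) = G"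
proof (rule rank_one_eqI[OF rank_one_image[OF rank_one_tensor[OF f_dual]] rank_one_G])
  define q where "q u h = tr (G \<circ> \<psi> (u \<odot> h)) - f u * h x" for u h
  have bop: "bop G" "\<And>u h. h \<in> dual \<Longrightarrow> bop (\<psi> (u \<odot> h))"
    using rank_one_G rank_one_image bop_rank_one by simp_all
  have "q u h = 0" if "h \<in> dual" for u h
  proof (rule biadditive_zero_if_generically_zero[OF f0_normalized _ _ _ that])
    show "q (u + v) h = q u h + q v h" if "h \<in> dual" for u v h
      using image_add[of "u \<odot> h" "v \<odot> h"] that rank_one_G bop f_dual
      by (simp add: q_def tr_comp_add dualD algebra_simps flip: tensor_add_left)
    show "q u (\<lambda>v. h v + k v) = q u h + q u k" if "h \<in> dual" "k \<in> dual" for u h k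
      using image_add[of "u \<odot> h" "u \<odot> k"] that rank_one_G bop
      by (simp add: q_def tr_comp_add dual_add algebra_simps flip: tensor_add_right)
    fix u h assume h_dual: "h \<in> dual" and "f0 u \<noteq> 0" "h x0 \<noteq> 0"
    have "tr (G \<circ> \<psi> (u \<odot> h)) * (f0 u * h x0) = (f0 u * h x) * (f u * h x0)"
      using cross[OF rank_one_image[OF rank_one_tensor[OF h_dual]], of u] f0_normalized(1) f_dual h_dual
      by (simp add: tr_form_tensor)
    then show "q u h = 0" using \<open>f0 u \<noteq> 0\<close> \<open>h x0 \<noteq> 0\<close> by (simp add: q_def field_simps)
  qed
  moreover fix X assume "rank_one X"
  then obtain u h where "h \<in> dual" "X = u \<odot> h" by (rule rank_oneE)
  ultimately show "tr (\<psi> X \<circ> \<psi> (x \<odot> f)) = tr (\<psi> X \<circ> G)"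
    using tr_comp_commute[OF rank_one_G bop(2), of h u] tr_form_tensor[of h f u x] f_dual
    by (simp add: q_def)
qed

lemma rank_one_base_image: "rank_one base_image" "tr base_image = 1"
  and rank_one_col_image: "rank_one (col_image x)"
  and rank_one_row_image: "f \<in> dual \<Longrightarrow> rank_one (row_image f)"
  using f0_normalized by (simp_all add: rank_one_image tr_image)

lemma columns_share_factor:
  "(\<forall>x. col_image x \<circ> base_image = col_image x) \<or> (\<forall>x. base_image \<circ> col_image x = col_image x)"
proof -
  have add: "col_image x \<boxplus> col_image y = col_image (x + y)" for x y
    unfolding tensor_add_left
    by (rule image_add[symmetric]) (simp_all add: f0_normalized(1) flip: tensor_add_left)
  have "(\<forall>R\<in>range (\<lambda>x. col_image x). R \<circ> base_image = R) \<or>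
      (\<forall>R\<in>range (\<lambda>x. col_image x). base_image \<circ> R = R)"
  proof (rule rank_one_additive_family[OF _ rank_one_base_image(2)])
    show "base_image \<in> range (\<lambda>x. col_image x)" by (rule rangeI)
    show "rank_one R" if "R \<in> range (\<lambda>x. col_image x)" for R using that rank_one_col_image by auto
    show "R \<boxplus> S \<in> range (\<lambda>x. col_image x)"
      if "R \<in> range (\<lambda>x. col_image x)" "S \<in> range (\<lambda>x. col_image x)" for R S
      using that by (elim rangeE) (simp only: add, blast)
  qed
  then show ?thesis by blast
qed

lemma rows_share_factor:
  "(\<forall>f\<in>dual. row_image f \<circ> base_image = row_image f) \<or> (\<forall>f\<in>dual. base_image \<circ> row_image f = row_image f)"
proof -
  have add: "row_image f \<boxplus> row_image g = row_image (\<lambda>u. f u + g u)" if "f \<in> dual" "g \<in> dual" for f g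
    unfolding tensor_add_right
    by (rule image_add[symmetric]) (simp_all add: that dual_add flip: tensor_add_right)
  have "(\<forall>R\<in>(\<lambda>f. row_image f) ` dual. R \<circ> base_image = R) \<or>
      (\<forall>R\<in>(\<lambda>f. row_image f) ` dual. base_image \<circ> R = R)"
  proof (rule rank_one_additive_family[OF _ rank_one_base_image(2)])
    show "base_image \<in> (\<lambda>f. row_image f) ` dual" using f0_normalized(1) by (rule imageI)
    show "rank_one R" if "R \<in> (\<lambda>f. row_image f) ` dual" for R using that rank_one_row_image by auto
    show "R \<boxplus> S \<in> (\<lambda>f. row_image f) ` dual"
      if "R \<in> (\<lambda>f. row_image f) ` dual" "S \<in> (\<lambda>f. row_image f) ` dual" for R S
      using that by (elim imageE) (simp only: add, blast intro: dual_add)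
  qed
  then show ?thesis by blast
qed

text \<open>The hypothesis gives \<open>f x = f x0 * f0 x\<close> for all x, so that \<open>row_image f\<close> is a multiple of \<open>base_image\<close>.\<close>

lemma row_commutes_if_columns_share_factor:
  assumes f_dual: "f \<in> dual"
    and common: "(\<forall>x. col_image x \<circ> base_image = col_image x) \<and> row_image f \<circ> base_image = row_image f \<or>
      (\<forall>x. base_image \<circ> col_image x = col_image x) \<and> base_image \<circ> row_image f = row_image f"
  shows "row_image f \<circ> base_image = row_image f \<and> base_image \<circ> row_image f = row_image f"
proof -
  have "f x = f x0 * f0 x" for x
  proof -
    have "tr (col_image x \<circ> row_image f) = tr (col_image x) * tr (row_image f)"
      by (rule tr_comp_if_common_factor[OF rank_one_base_image bop_rank_one bop_rank_one])
        (use common rank_one_col_image rank_one_row_image[OF f_dual] in blast)+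
    then show ?thesis using f_dual f0_normalized by (simp add: tr_form_tensor tr_image)
  qed
  then have "f = (\<lambda>x. f x0 * f0 x)" by (rule ext)
  then have "x0 \<odot> f = f x0 \<boxdot> x0 \<odot> f0" by (metis tensor_scale_right)
  then have "row_image f = f x0 \<boxdot> base_image" using f0_normalized(1) by (simp add: image_scale)
  moreover have "base_image (base_image u) = base_image u" for u
    using fun_cong[OF rank_one_square[OF rank_one_base_image(1)], of u] rank_one_base_image(2) by simp
  ultimately show ?thesis
    using bop_rank_one[OF rank_one_base_image(1)] by (simp add: fun_eq_iff bopD)
qed

lemma columns_rows_opposite_factors:
  "(\<forall>x. col_image x \<circ> base_image = col_image x) \<and> (\<forall>f\<in>dual. base_image \<circ> row_image f = row_image f) \<or>
   (\<forall>x. base_image \<circ> col_image x = col_image x) \<and> (\<forall>f\<in>dual. row_image f \<circ> base_image = row_image f)"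
  using columns_share_factor rows_share_factor row_commutes_if_columns_share_factor by blast

theorem image_tensor_factorization:
  "(\<forall>x. \<forall>f\<in>dual. \<psi> (x \<odot> f) = col_image x \<circ> row_image f) \<or>
      (\<forall>x. \<forall>f\<in>dual. \<psi> (x \<odot> f) = row_image f \<circ> col_image x)"
  using columns_rows_opposite_factors
proof (elim disjE conjE)
  assume columns: "\<forall>x. col_image x \<circ> base_image = col_image x"
    and rows: "\<forall>f\<in>dual. base_image \<circ> row_image f = row_image f"
  have "\<psi> (x \<odot> f) = col_image x \<circ> row_image f" if f_dual: "f \<in> dual" for x f
  proof (rule image_tensor_eqI[OF f_dual
      rank_one_comp_right[OF rank_one_col_image bop_rank_one[OF rank_one_row_image[OF f_dual]]]])
    fix X assume "rank_one X"
    then show "tr (col_image x \<circ> row_image f \<circ> X) * tr (base_image \<circ> X) =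
        tr (col_image x \<circ> X) * tr (row_image f \<circ> X)"
      using columns rows f_dual
      by (intro tr_comp_cross rank_one_base_image bop_rank_one rank_one_col_image rank_one_row_image) auto
  qed
  then show ?thesis by blast
next
  assume columns: "\<forall>x. base_image \<circ> col_image x = col_image x"
    and rows: "\<forall>f\<in>dual. row_image f \<circ> base_image = row_image f"
  have "\<psi> (x \<odot> f) = row_image f \<circ> col_image x" if f_dual: "f \<in> dual" for x f
  proof (rule image_tensor_eqI[OF f_dual
      rank_one_comp_right[OF rank_one_row_image[OF f_dual] bop_rank_one[OF rank_one_col_image]]])
    fix X assume "rank_one X"
    then have "tr (row_image f \<circ> col_image x \<circ> X) * tr (base_image \<circ> X) =
        tr (row_image f \<circ> X) * tr (col_image x \<circ> X)"
      using columns rows f_dual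
      by (intro tr_comp_cross rank_one_base_image bop_rank_one rank_one_col_image rank_one_row_image) auto
    then show "tr (row_image f \<circ> col_image x \<circ> X) * tr (base_image \<circ> X) =
        tr (col_image x \<circ> X) * tr (row_image f \<circ> X)"
      by simp
  qed
  then show ?thesis by blast
qed

lemma columns_first_factorization:
  assumes factors: "\<forall>x. \<forall>f\<in>dual. \<psi> (x \<odot> f) = col_image x \<circ> row_image f"
  shows "\<exists>S C. (\<forall>f\<in>dual. C f \<in> dual) \<and> (\<forall>x. \<forall>f\<in>dual. \<psi> (x \<odot> f) = S x \<odot> C f)"
proof -
  obtain y0 g0 where base: "g0 \<in> dual" "base_image = y0 \<odot> g0"
    using rank_one_base_image(1) by (rule rank_oneE)
  show ?thesis
  proof (intro exI conjI allI ballI)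
    fix x and f assume f_dual: "f \<in> dual"
    have "col_image x = col_image x \<circ> base_image" using factors f0_normalized(1) by blast
    also have "\<dots> = col_image x y0 \<odot> g0"
      unfolding base(2) by (rule comp_tensor[OF bop_rank_one[OF rank_one_col_image]])
    finally have col_tensor: "col_image x = col_image x y0 \<odot> g0" .
    have "\<psi> (x \<odot> f) = col_image x \<circ> row_image f" using factors f_dual by blast
    then show "\<psi> (x \<odot> f) = col_image x y0 \<odot> (\<lambda>u. g0 (row_image f u))"
      using col_tensor tensor_comp by metis
  qed (rule dual_comp[OF base(1) bop_rank_one[OF rank_one_row_image]])
qed

lemma rows_first_factorization:
  assumes factors: "\<forall>x. \<forall>f\<in>dual. \<psi> (x \<odot> f) = row_image f \<circ> col_image x"
  shows "\<exists>S C. (\<forall>x. C x \<in> dual) \<and> (\<forall>x. \<forall>f\<in>dual. \<psi> (x \<odot> f) = S f \<odot> C x)"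
proof -
  obtain y0 g0 where base: "g0 \<in> dual" "base_image = y0 \<odot> g0"
    using rank_one_base_image(1) by (rule rank_oneE)
  show ?thesis
  proof (intro exI conjI allI ballI)
    show "(\<lambda>u. g0 (col_image x u)) \<in> dual" for x
      by (rule dual_comp[OF base(1) bop_rank_one[OF rank_one_col_image]])
    fix x and f assume f_dual: "f \<in> dual"
    have "row_image f = row_image f \<circ> base_image" using factors f_dual by blast
    also have "\<dots> = row_image f y0 \<odot> g0"
      unfolding base(2) by (rule comp_tensor[OF bop_rank_one[OF rank_one_row_image[OF f_dual]]])
    finally have row_tensor: "row_image f = row_image f y0 \<odot> g0" .
    have "\<psi> (x \<odot> f) = row_image f \<circ> col_image x" using factors f_dual by blast
    then show "\<psi> (x \<odot> f) = row_image f y0 \<odot> (\<lambda>u. g0 (col_image x u))"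
      using row_tensor tensor_comp by metis
  qed
qed

end

end

section \<open>Spatial form\<close>

text \<open>Applied once with \<open>elem x f = x \<odot> f\<close>, where A acts on vectors by \<open>x \<mapsto> A x\<close>, and once with
  \<open>elem f x = x \<odot> f\<close>, where A acts on functionals by \<open>f \<mapsto> f \<circ> A\<close>.\<close>

locale rank_one_factorization = trace_form_preserver smul \<A> \<psi>
  for smul :: "complex \<Rightarrow> 'a::banach \<Rightarrow> 'a" and \<A> and \<psi> +
  fixes V :: "'v set" and W :: "'w set" and elem :: "'v \<Rightarrow> 'w \<Rightarrow> 'a \<Rightarrow> 'a"
    and act :: "('a \<Rightarrow> 'a) \<Rightarrow> 'v \<Rightarrow> 'v" and scale :: "complex \<Rightarrow> 'v \<Rightarrow> 'v"
    and S :: "'v \<Rightarrow> 'a" and C :: "'w \<Rightarrow> 'a \<Rightarrow> complex"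
  assumes rank_one_elem: "v \<in> V \<Longrightarrow> w \<in> W \<Longrightarrow> rank_one (elem v w)"
    and elem_cases: "rank_one R \<Longrightarrow> \<exists>v\<in>V. \<exists>w\<in>W. R = elem v w"
    and act: "A \<in> \<A> \<Longrightarrow> v \<in> V \<Longrightarrow> act A v \<in> V"
    and tr_act: "A \<in> \<A> \<Longrightarrow> v \<in> V \<Longrightarrow> w \<in> W \<Longrightarrow> tr (elem v w \<circ> A) = tr (elem (act A v) w)"
    and scale: "v \<in> V \<Longrightarrow> scale c v \<in> V"
    and tr_scale_elem: "v \<in> V \<Longrightarrow> w \<in> W \<Longrightarrow> tr (elem (scale c v) w) = c * tr (elem v w)"
    and C_dual: "w \<in> W \<Longrightarrow> C w \<in> dual"
    and factorization: "v \<in> V \<Longrightarrow> w \<in> W \<Longrightarrow> \<psi> (elem v w) = S v \<odot> C w"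
begin

lemma C_S: "v \<in> V \<Longrightarrow> w \<in> W \<Longrightarrow> C w (S v) = tr (elem v w)"
  using tr_image[OF rank_one_elem] by (simp add: factorization C_dual)

lemma C_separates:
  assumes "\<And>w. w \<in> W \<Longrightarrow> C w y = C w z"
  shows "y = z"
proof (rule ccontr)
  assume "y \<noteq> z"
  then have "y - z \<noteq> 0" by simp
  then obtain g where g_separates: "g \<in> dual" "g (y - z) = 1" by (rule exists_dual)
  have "y \<odot> g = z \<odot> g"
  proof (rule rank_one_eqI)
    fix X assume "rank_one X"
    then obtain v w where "v \<in> V" "w \<in> W" "X = elem v w" using elem_cases by blast
    then show "tr (\<psi> X \<circ> y \<odot> g) = tr (\<psi> X \<circ> z \<odot> g)"
      using g_separates(1) C_dual assms
      by (simp add: factorization tr_comp_tensor bop_tensor tensor_apply)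
  qed (simp_all add: g_separates(1))
  from fun_cong[OF this, of "y - z"] show False using \<open>y \<noteq> z\<close> g_separates(2) by (simp add: tensor_apply)
qed

lemma S_eqI: "v \<in> V \<Longrightarrow> (\<And>w. w \<in> W \<Longrightarrow> C w y = tr (elem v w)) \<Longrightarrow> S v = y"
  by (rule C_separates) (simp add: C_S)

lemma S_scale: "v \<in> V \<Longrightarrow> S (scale c v) = smul c (S v)"
  using C_dual by (intro S_eqI scale) (simp_all add: dualD tr_scale_elem C_S)

lemma intertwining:
  assumes A_algebra: "A \<in> \<A>" and v_in: "v \<in> V"
  shows "\<psi> A (S v) = S (act A v)"
proof (rule S_eqI[symmetric, OF act[OF A_algebra v_in]])
  fix w assume w_in: "w \<in> W"
  have "C w (\<psi> A (S v)) = tr (\<psi> (elem v w) \<circ> \<psi> A)"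
    using image_bop[OF A_algebra] C_dual[OF w_in] by (simp add: factorization v_in w_in tr_tensor_comp)
  also have "\<dots> = tr (elem (act A v) w)"
    using tr_form[OF rank_one_elem[OF v_in w_in] A_algebra] tr_act[OF A_algebra v_in w_in] by simp
  finally show "C w (\<psi> A (S v)) = tr (elem (act A v) w)" .
qed

lemma exists_nonzero_on_range:
  assumes h_dual: "h \<in> dual" and "h y \<noteq> 0"
  obtains v where "v \<in> V" "h (S v) \<noteq> 0"
proof (rule ccontr)
  assume "\<not> thesis"
  then have vanish: "h (S v) = 0" if "v \<in> V" for v
    using that \<open>\<And>v. v \<in> V \<Longrightarrow> h (S v) \<noteq> 0 \<Longrightarrow> thesis\<close> by blast
  have "y \<odot> h = 0 \<odot> h"
  proof (rule rank_one_eqI)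
    fix X assume "rank_one X"
    then obtain v w where "v \<in> V" "w \<in> W" "X = elem v w" using elem_cases by blast
    then show "tr (\<psi> X \<circ> y \<odot> h) = tr (\<psi> X \<circ> 0 \<odot> h)"
      using h_dual C_dual vanish
      by (simp add: factorization tr_comp_tensor bop_tensor tensor_apply dualD)
  qed (simp_all add: h_dual)
  from fun_cong[OF this, of y] show False using \<open>h y \<noteq> 0\<close> h_dual by (auto simp: tensor_apply dualD)
qed

lemma surj_S: "S ` V = UNIV"
proof (intro equalityI subsetI UNIV_I)
  fix y :: 'a
  show "y \<in> S ` V"
  proof (cases "y = 0")
    case True
    obtain v where v_in: "v \<in> V" using elem_cases[OF rank_one_zero] by blast
    then have "S (scale 0 v) = y" using True by (simp add: S_scale)
    then show ?thesis using scale[OF v_in] by blast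
  next
    case False
    then obtain h where h_normalized: "h \<in> dual" "h y = 1" by (rule exists_dual)
    obtain v where v_in: "v \<in> V" "h (S v) \<noteq> 0"
      using exists_nonzero_on_range[of h y] h_normalized by auto
    obtain B where preimage: "B \<in> \<A>" "\<psi> B = y \<odot> h"
      using rank_one_preimage[OF rank_one_tensor[OF h_normalized(1)]] by blast
    have "smul (h (S v)) y = S (act B v)"
      using intertwining[OF preimage(1) v_in(1)] by (simp add: preimage(2) tensor_apply)
    then have "S (scale (1 / h (S v)) (act B v)) = y"
      using v_in(2)
      by (simp add: S_scale act preimage(1) v_in(1) flip: \<open>smul (h (S v)) y = S (act B v)\<close>)
    then show ?thesis using scale[OF act[OF preimage(1) v_in(1)]] by blast
  qed
qed

lemma weak_form:
  assumes h_dual: "h \<in> dual"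
  shows "\<exists>A\<in>\<A>. \<exists>w\<in>W. \<exists>c. \<forall>v\<in>V. h (S v) = c * tr (elem v w \<circ> A)"
proof (cases "\<exists>y. y \<noteq> (0::'a)")
  case False
  then have "h (S v) = 0" for v using dualD(4)[OF h_dual] by metis
  moreover obtain w where "w \<in> W" using elem_cases[OF rank_one_zero] by blast
  ultimately show ?thesis
    using algebra_rank_one[OF rank_one_zero] by (intro bexI[of _ "\<lambda>_. 0"] bexI[of _ w] exI[of _ 0]) auto
next
  case True
  then obtain y :: 'a where "y \<noteq> 0" by blast
  then obtain w where w_in: "w \<in> W" "C w y \<noteq> 0"
    using C_separates[of y 0] dualD(4)[OF C_dual] by metis
  obtain B where preimage: "B \<in> \<A>" "\<psi> B = y \<odot> h"
    using rank_one_preimage[OF rank_one_tensor[OF h_dual]] by blast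
  show ?thesis
  proof (intro bexI exI ballI)
    fix v assume v_in: "v \<in> V"
    have "tr (elem v w \<circ> B) = C w (\<psi> B (S v))"
      by (simp add: intertwining[OF preimage(1) v_in] C_S[OF act[OF preimage(1) v_in] w_in(1)]
          tr_act[OF preimage(1) v_in w_in(1)])
    also have "\<dots> = h (S v) * C w y"
      by (simp add: preimage(2) tensor_apply dualD(3)[OF C_dual[OF w_in(1)]])
    finally show "h (S v) = (1 / C w y) * tr (elem v w \<circ> B)" using w_in(2) by simp
  qed (fact preimage(1) w_in(1))+
qed

end

context trace_form_preserver
begin

lemma spatial:
  assumes C_dual: "\<forall>f\<in>dual. C f \<in> dual" and factorization: "\<forall>x. \<forall>f\<in>dual. \<psi> (x \<odot> f) = S x \<odot> C f"
  shows "invertible_op smul S" and "\<And>A. A \<in> \<A> \<Longrightarrow> \<psi> A = (\<lambda>x. S (A (inv S x)))"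
proof -
  interpret rank_one_factorization smul \<A> \<psi> UNIV dual "(\<odot>)" "\<lambda>A x. A x" smul S C
  proof
    show "\<exists>x\<in>UNIV. \<exists>f\<in>dual. R = x \<odot> f" if "rank_one R" for R using that by (elim rank_oneE) blast
    show "tr (x \<odot> f \<circ> A) = tr (A x \<odot> f)" if "A \<in> \<A>" "f \<in> dual" for A x f
      using that by (simp add: tr_tensor_comp algebra_bop)
  qed (simp_all add: C_dual factorization dualD)
  have "bop S"
  proof (rule bop_if_weakly_bounded)
    show "S (x + y) = S x + S y" for x y by (rule S_eqI) (simp_all add: C_S dualD C_dual)
    show "S (smul c x) = smul c (S x)" for c x by (rule S_scale) simp
    fix h assume "h \<in> dual"
    from weak_form[OF this] obtain A f c
      where "A \<in> \<A>" "f \<in> dual" "\<And>x. h (S x) = c * tr (x \<odot> f \<circ> A)" by auto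
    then show "(\<lambda>x. h (S x)) \<in> dual"
      by (simp add: tr_tensor_comp algebra_bop dual_scale dual_comp)
  qed
  moreover have "inj S"
  proof (rule injI)
    fix x y assume "S x = S y"
    then have "f x = f y" if "f \<in> dual" for f using C_S[of x f] C_S[of y f] that by simp
    then show "x = y" by (rule dual_separates)
  qed
  ultimately show "invertible_op smul S" using surj_S by (simp add: invertible_op_def bij_def)
  show "\<psi> A = (\<lambda>x. S (A (inv S x)))" if "A \<in> \<A>" for A
  proof
    fix y
    have "\<psi> A (S (inv S y)) = S (A (inv S y))" by (rule intertwining[OF that UNIV_I])
    then show "\<psi> A y = S (A (inv S y))" using surj_S by (simp add: surj_f_inv_f)
  qed
qed

lemma dual_spatial:
  assumes C_dual: "\<forall>x. C x \<in> dual" and factorization: "\<forall>x. \<forall>f\<in>dual. \<psi> (x \<odot> f) = S f \<odot> C x"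
  shows "invertible_dual_op smul S" and "\<And>A. A \<in> \<A> \<Longrightarrow> \<psi> A = (\<lambda>x. S (inv_into dual S x \<circ> A))"
proof -
  have dual_comp_algebra: "f \<circ> A \<in> dual" if "f \<in> dual" "A \<in> \<A>" for f A
    using dual_comp[OF that(1) algebra_bop[OF that(2)]] by (simp add: comp_def)
  interpret rank_one_factorization smul \<A> \<psi> dual UNIV "\<lambda>f x. x \<odot> f" "\<lambda>A f. f \<circ> A" "\<lambda>c f u. c * f u" S C
  proof
    show "\<exists>f\<in>dual. \<exists>x\<in>UNIV. R = x \<odot> f" if "rank_one R" for R using that by (elim rank_oneE) blast
    show "tr (x \<odot> f \<circ> A) = tr (x \<odot> (f \<circ> A))" for A x f
      by (subst tensor_comp) (simp only: comp_def)
  qed (simp_all add: C_dual factorization dual_comp_algebra dual_scale)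
  have C_S_apply: "C x (S f) = f x" if "f \<in> dual" for f x using C_S[OF that UNIV_I, of x] that by simp
  have S_add: "S (\<lambda>u. f u + g u) = S f + S g" if "f \<in> dual" "g \<in> dual" for f g
  proof (rule S_eqI)
    show "C x (S f + S g) = tr (x \<odot> (\<lambda>u. f u + g u))" for x
      using that by (simp add: dualD[OF C_dual] C_S_apply dual_add)
  qed (use that in auto)
  have "\<exists>K. \<forall>f\<in>dual. norm (S f) \<le> K * onorm f"
  proof (rule dual_map_bounded_if_weak_star_continuous[OF S_add S_scale])
    fix h assume "h \<in> dual"
    from weak_form[OF this] obtain A x c
      where "A \<in> \<A>" "\<forall>f\<in>dual. h (S f) = c * tr (x \<odot> f \<circ> A)" by auto
    then have "\<forall>f\<in>dual. h (S f) = c * f (A x)" by (simp add: tr_tensor_comp algebra_bop)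
    then show "\<exists>c u. \<forall>f\<in>dual. h (S f) = c * f u" by (intro exI)
  qed
  moreover have "inj_on S dual"
  proof (rule inj_onI)
    fix f g assume "f \<in> dual" "g \<in> dual" "S f = S g"
    then show "f = g" using C_S_apply[of f] C_S_apply[of g] by (simp add: fun_eq_iff)
  qed
  ultimately show "invertible_dual_op smul S"
    using surj_S S_add S_scale by (simp add: invertible_dual_op_def bij_betw_def)
  show "\<psi> A = (\<lambda>x. S (inv_into dual S x \<circ> A))" if "A \<in> \<A>" for A
  proof
    fix y
    have "\<psi> A (S (inv_into dual S y)) = S (inv_into dual S y \<circ> A)"
      using surj_S by (intro intertwining[OF that] inv_into_into) simp
    then show "\<psi> A y = S (inv_into dual S y \<circ> A)" using surj_S by (simp add: f_inv_into_f)
  qed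
qed

theorem spatial_or_dual_spatial:
  assumes "(x0::'a) \<noteq> 0"
  shows "(\<exists>S. invertible_op smul S \<and> (\<forall>A\<in>\<A>. \<psi> A = (\<lambda>x. S (A (inv S x))))) \<or>
    (\<exists>S. invertible_dual_op smul S \<and> (\<forall>A\<in>\<A>. \<psi> A = (\<lambda>x. S (inv_into dual S x \<circ> A))))"
proof -
  obtain f0 where f0_normalized: "f0 \<in> dual" "f0 x0 = 1" using assms by (rule exists_dual)
  from image_tensor_factorization[OF f0_normalized] show ?thesis
  proof
    assume "\<forall>x. \<forall>f\<in>dual. \<psi> (x \<odot> f) = \<psi> (x \<odot> f0) \<circ> \<psi> (x0 \<odot> f)"
    from columns_first_factorization[OF f0_normalized this]
    obtain S C where factorization: "\<forall>f\<in>dual. C f \<in> dual" "\<forall>x. \<forall>f\<in>dual. \<psi> (x \<odot> f) = S x \<odot> C f"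
      by blast
    show ?thesis
    proof (intro disjI1 exI conjI ballI)
      show "invertible_op smul S" by (rule spatial(1)[OF factorization])
      show "\<psi> A = (\<lambda>x. S (A (inv S x)))" if "A \<in> \<A>" for A by (rule spatial(2)[OF factorization that])
    qed
  next
    assume "\<forall>x. \<forall>f\<in>dual. \<psi> (x \<odot> f) = \<psi> (x0 \<odot> f) \<circ> \<psi> (x \<odot> f0)"
    from rows_first_factorization[OF f0_normalized this]
    obtain S C where factorization: "\<forall>x. C x \<in> dual" "\<forall>x. \<forall>f\<in>dual. \<psi> (x \<odot> f) = S f \<odot> C x"
      by blast
    show ?thesis
    proof (intro disjI2 exI conjI ballI)
      show "invertible_dual_op smul S" by (rule dual_spatial(1)[OF factorization])
      show "\<psi> A = (\<lambda>x. S (inv_into dual S x \<circ> A))" if "A \<in> \<A>" for A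
        by (rule dual_spatial(2)[OF factorization that])
    qed
  qed
qed

end

section \<open>Normalization by a root of unity\<close>

locale idempotent_rank_preserver = power_trace_map +
  assumes rank_one_image_idempotent: "rank_one P \<Longrightarrow> tr P = 1 \<Longrightarrow> rank_one (\<phi> P)"
begin

lemma rank_one_image_if_tr_nonzero:
  assumes rank_one_R: "rank_one R" and "tr R \<noteq> 0"
  shows "rank_one (\<phi> R)"
proof -
  let ?P = "(1 / tr R) \<boxdot> R"
  have idempotent: "rank_one ?P" "tr ?P = 1"
    using rank_one_R assms(2) by (simp_all only: rank_one_scale tr_scale) simp
  have "rank_one (tr R \<boxdot> \<phi> ?P)" by (rule rank_one_scale[OF rank_one_image_idempotent[OF idempotent]])
  also have "tr R \<boxdot> \<phi> ?P = \<phi> R" using assms(2) by (simp flip: image_scale[OF idempotent(1)])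
  finally show ?thesis .
qed

lemma rank_one_image:
  assumes rank_one_R: "rank_one R"
  shows "rank_one (\<phi> R)"
proof -
  consider (nonzero_trace) "tr R \<noteq> 0" | (zero) "R = (\<lambda>_. 0)" | (zero_trace) "tr R = 0" "R \<noteq> (\<lambda>_. 0)"
    by blast
  then show ?thesis
  proof cases
    case nonzero_trace then show ?thesis by (rule rank_one_image_if_tr_nonzero[OF rank_one_R])
  next
    case zero then show ?thesis by (simp add: image_zero rank_one_zero)
  next
    case zero_trace
    obtain S where rank_one_S: "rank_one S"
      and line: "\<And>c. rank_one (S \<boxplus> c \<boxdot> R)" "\<And>c. tr (S \<boxplus> c \<boxdot> R) \<noteq> 0"
      using rank_one_trace_shift[OF rank_one_R zero_trace] by blast
    have "\<phi> (S \<boxplus> c \<boxdot> R) = \<phi> S \<boxplus> c \<boxdot> \<phi> R" for c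
      using image_add[OF rank_one_S rank_one_scale[OF rank_one_R] line(1)]
      by (simp add: image_scale[OF rank_one_R])
    then have "rank_one (\<phi> S \<boxplus> c \<boxdot> \<phi> R)" for c
      using rank_one_image_if_tr_nonzero[OF line] by metis
    from this[of 0] this[of 1] this[of 2] show ?thesis by (auto intro: rank_one_direction[of "\<phi> S"])
  qed
qed

lemma tr_image_power:
  assumes rank_one_R: "rank_one R"
  shows "tr (\<phi> R) ^ (n + 2) = tr R ^ (n + 2)"
proof -
  have "tr (\<phi> R ^^ Suc n \<circ> \<phi> R) = tr (R ^^ Suc n \<circ> R)"
    using rank_one_R by (intro tr_power algebra_rank_one) (simp_all add: rank_one_image)
  then show ?thesis
    by (simp only: tr_funpow[OF rank_one_R] tr_funpow[OF rank_one_image[OF rank_one_R]]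
        funpow_Suc_right[symmetric] add_2_eq_Suc')
qed

lemma tr_image_root_of_unity:
  assumes idempotent_P: "rank_one P" "tr P = 1"
  obtains \<xi> where "\<xi> ^ (n + 2) = 1" "\<And>R. rank_one R \<Longrightarrow> tr (\<phi> R) = \<xi> * tr R"
proof (rule that[of "tr (\<phi> P)"])
  show "tr (\<phi> P) ^ (n + 2) = 1"
    by (simp only: tr_image_power[OF idempotent_P(1)] idempotent_P(2) power_one)
  fix R assume rank_one_R: "rank_one R"
  show "tr (\<phi> R) = tr (\<phi> P) * tr R"
  proof (rule rank_one_functional_proportional_to_tr[OF _ _ _ idempotent_P rank_one_R])
    show "tr (\<phi> (S \<boxplus> T)) = tr (\<phi> S) + tr (\<phi> T)" if "rank_one S" "rank_one T" "rank_one (S \<boxplus> T)" for S T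
      using that by (simp only: image_add tr_add rank_one_image)
    show "tr (\<phi> (c \<boxdot> S)) = c * tr (\<phi> S)" if "rank_one S" for c S
      using that by (simp only: image_scale tr_scale rank_one_image)
    show "tr (\<phi> S) = 0" if "rank_one S" "tr S = 0" for S
      using tr_image_power[OF that(1)] that(2) by auto
  qed
qed

context
  fixes \<xi> :: complex
  assumes root_of_unity: "\<xi> ^ (n + 2) = 1" and tr_image: "\<And>R. rank_one R \<Longrightarrow> tr (\<phi> R) = \<xi> * tr R"
begin

lemma \<xi>_nonzero: "\<xi> \<noteq> 0"
  using root_of_unity by auto

lemma tr_comp_image_if_tr_nonzero:
  assumes rank_one_R: "rank_one R" "tr R \<noteq> 0" and B_algebra: "B \<in> \<A>"
  shows "tr (\<phi> R \<circ> \<phi> B) = \<xi>\<^sup>2 * tr (R \<circ> B)"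
proof -
  have "tr (\<phi> R ^^ Suc n \<circ> \<phi> B) = tr (R ^^ Suc n \<circ> B)"
    using rank_one_R(1) rank_one_image by (intro tr_power[OF algebra_rank_one B_algebra]) blast+
  then have "\<xi> ^ n * tr (\<phi> R \<circ> \<phi> B) = tr (R \<circ> B)"
    using rank_one_R algebra_bop[OF B_algebra] image_bop[OF B_algebra]
    by (simp add: tr_rank_one_funpow_comp rank_one_image tr_image power_mult_distrib del: funpow.simps)
  then have "\<xi> ^ (n + 2) * tr (\<phi> R \<circ> \<phi> B) = \<xi>\<^sup>2 * tr (R \<circ> B)"
    by (simp add: power_add power2_eq_square mult_ac)
  then show ?thesis by (simp only: root_of_unity mult_1)
qed

lemma tr_comp_image_rank_one:
  assumes rank_one_R: "rank_one R" and B_algebra: "B \<in> \<A>"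
  shows "tr (\<phi> R \<circ> \<phi> B) = \<xi>\<^sup>2 * tr (R \<circ> B)"
proof -
  consider (nonzero_trace) "tr R \<noteq> 0" | (zero) "R = (\<lambda>_. 0)" | (zero_trace) "tr R = 0" "R \<noteq> (\<lambda>_. 0)"
    by blast
  then show ?thesis
  proof cases
    case nonzero_trace then show ?thesis
      by (rule tr_comp_image_if_tr_nonzero[OF rank_one_R _ B_algebra])
  next
    case zero then show ?thesis by (simp add: image_zero comp_def)
  next
    case zero_trace
    obtain S where rank_one_S: "rank_one S"
      and line: "\<And>c. rank_one (S \<boxplus> c \<boxdot> R)" "\<And>c. tr (S \<boxplus> c \<boxdot> R) \<noteq> 0"
      using rank_one_trace_shift[OF rank_one_R zero_trace] by blast
    have rank_one_sum: "rank_one (S \<boxplus> R)" "tr (S \<boxplus> R) \<noteq> 0" and "tr S \<noteq> 0"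
      using line[of 1] line[of 0] by simp_all
    have "tr (\<phi> (S \<boxplus> R) \<circ> \<phi> B) = tr (\<phi> S \<circ> \<phi> B) + tr (\<phi> R \<circ> \<phi> B)"
      using rank_one_S rank_one_R rank_one_sum(1) image_bop[OF B_algebra]
      by (simp only: image_add tr_add_comp rank_one_image)
    moreover have "tr ((S \<boxplus> R) \<circ> B) = tr (S \<circ> B) + tr (R \<circ> B)"
      by (rule tr_add_comp[OF rank_one_S rank_one_R algebra_bop[OF B_algebra]])
    ultimately show ?thesis
      using tr_comp_image_if_tr_nonzero[OF rank_one_sum B_algebra]
        tr_comp_image_if_tr_nonzero[OF rank_one_S \<open>tr S \<noteq> 0\<close> B_algebra]
      by (simp add: algebra_simps)
  qed
qed

lemma trace_form_preserver_normalized: "trace_form_preserver smul \<A> (\<lambda>A. (1 / \<xi>) \<boxdot> \<phi> A)"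
proof
  let ?\<psi> = "\<lambda>A. (1 / \<xi>) \<boxdot> \<phi> A"
  show "?\<psi> A \<in> \<A>" if "A \<in> \<A>" for A by (rule algebra_scale[OF maps[OF that]])
  show "R \<boxplus> S \<in> ?\<psi> ` \<A>" if rank_one_R: "rank_one R" and rank_one_S: "rank_one S" for R S
  proof -
    obtain C where preimage: "\<xi> \<boxdot> R \<boxplus> \<xi> \<boxdot> S = \<phi> C" "C \<in> \<A>"
      using rank_two_in_range[OF rank_one_scale[OF rank_one_R] rank_one_scale[OF rank_one_S]]
      by (rule imageE)
    have "R \<boxplus> S = ?\<psi> C" by (simp add: \<xi>_nonzero cv.scale_right_distrib flip: preimage(1))
    then show ?thesis using preimage(2) by (rule image_eqI)
  qed
  show "tr (?\<psi> A ^^ Suc 0 \<circ> ?\<psi> B) = tr (A ^^ Suc 0 \<circ> B)"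
    if A_algebra: "A \<in> \<A>" and B_algebra: "B \<in> \<A>" and rank: "rank_one A \<or> rank_one B" for A B
  proof -
    have form: "tr (\<phi> A \<circ> \<phi> B) = \<xi>\<^sup>2 * tr (A \<circ> B)"
      using rank
    proof
      assume "rank_one B"
      then have "tr (\<phi> A \<circ> \<phi> B) = tr (\<phi> B \<circ> \<phi> A)" "tr (A \<circ> B) = tr (B \<circ> A)"
        by (intro tr_comp_commute rank_one_image image_bop algebra_bop A_algebra; assumption)+
      then show ?thesis using tr_comp_image_rank_one[OF \<open>rank_one B\<close> A_algebra] by simp
    qed (rule tr_comp_image_rank_one[OF _ B_algebra])
    have "?\<psi> A \<circ> ?\<psi> B = (1 / \<xi>\<^sup>2) \<boxdot> (\<phi> A \<circ> \<phi> B)"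
      using image_bop[OF A_algebra] by (simp add: fun_eq_iff bopD power2_eq_square)
    moreover have "rank_one (\<phi> A \<circ> \<phi> B)"
      using rank rank_one_image rank_one_comp_left rank_one_comp_right image_bop A_algebra B_algebra
      by blast
    ultimately have "tr (?\<psi> A \<circ> ?\<psi> B) = (1 / \<xi>\<^sup>2) * tr (\<phi> A \<circ> \<phi> B)" by (simp only: tr_scale)
    then show ?thesis using form \<xi>_nonzero by simp
  qed
  fix R assume "rank_one R"
  then show "rank_one (?\<psi> R)" "tr (?\<psi> R) = tr R"
    using \<xi>_nonzero by (simp_all only: rank_one_scale tr_scale rank_one_image tr_image) simp
qed

end

theorem spatial_up_to_scalar:
  "\<exists>\<xi>::complex. \<xi> ^ (n + 2) = 1 \<and>
     ((\<exists>S. invertible_op smul S \<and> (\<forall>A\<in>\<A>. \<phi> A = (\<lambda>x. smul \<xi> (S (A (inv S x)))))) \<or>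
      (\<exists>S. invertible_dual_op smul S \<and> (\<forall>A\<in>\<A>. \<phi> A = (\<lambda>x. smul \<xi> (S (inv_into dual S x \<circ> A))))))"
proof (cases "\<exists>x0::'a. x0 \<noteq> 0")
  case False
  then have "x = y" for x y :: 'a by metis
  moreover from this have "\<phi> A = (\<lambda>x. smul 1 (id (A (inv id x))))" for A by blast
  moreover have "invertible_op smul id" by (simp add: invertible_op_def bop_id)
  ultimately show ?thesis by (intro exI[of _ 1] conjI disjI1 exI[of _ id]) auto
next
  case True
  then obtain x0 :: 'a where "x0 \<noteq> 0" by blast
  then obtain f0 where "f0 \<in> dual" "f0 x0 = 1" by (rule exists_dual)
  then obtain \<xi> where root_of_unity: "\<xi> ^ (n + 2) = 1" "\<And>R. rank_one R \<Longrightarrow> tr (\<phi> R) = \<xi> * tr R"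
    using tr_image_root_of_unity[of "x0 \<odot> f0"] by auto
  interpret normalized: trace_form_preserver smul \<A> "\<lambda>A. (1 / \<xi>) \<boxdot> \<phi> A"
    by (rule trace_form_preserver_normalized[OF root_of_unity])
  have rescale: "\<phi> A = \<xi> \<boxdot> T" if "(1 / \<xi>) \<boxdot> \<phi> A = T" for A T
    using \<xi>_nonzero[OF root_of_unity] by (simp flip: that)
  from normalized.spatial_or_dual_spatial[OF \<open>x0 \<noteq> 0\<close>] show ?thesis
  proof (elim disjE exE conjE)
    fix S assume invertible_S: "invertible_op smul S" and "\<forall>A\<in>\<A>. (1 / \<xi>) \<boxdot> \<phi> A = (\<lambda>x. S (A (inv S x)))"
    then have "\<forall>A\<in>\<A>. \<phi> A = (\<lambda>x. smul \<xi> (S (A (inv S x))))" using rescale by blast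
    then show ?thesis using invertible_S root_of_unity(1) by blast
  next
    fix S assume invertible_S: "invertible_dual_op smul S"
      and "\<forall>A\<in>\<A>. (1 / \<xi>) \<boxdot> \<phi> A = (\<lambda>x. S (inv_into dual S x \<circ> A))"
    then have "\<forall>A\<in>\<A>. \<phi> A = (\<lambda>x. smul \<xi> (S (inv_into dual S x \<circ> A)))" using rescale by blast
    then show ?thesis using invertible_S root_of_unity(1) by blast
  qed
qed

end

section \<open>Roots of rank one idempotents\<close>

definition sandwich :: "nat \<Rightarrow> nat \<Rightarrow> ('a \<Rightarrow> 'a) \<Rightarrow> ('a \<Rightarrow> 'a) \<Rightarrow> 'a \<Rightarrow> 'a" where
  "sandwich r s A B = A ^^ r \<circ> B \<circ> A ^^ s"

lemma sandwich_self: "sandwich r s A A = A ^^ Suc (r + s)"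
  by (simp add: sandwich_def funpow_add fun_eq_iff funpow_swap1)

lemma funpow_left_eigenvector:
  fixes w :: "'a \<Rightarrow> 'b::monoid_mult"
  assumes "\<And>u. w (U u) = c * w u"
  shows "w ((U ^^ j) u) = c ^ j * w u"
  by (induction j) (simp_all add: assms mult.assoc)

lemma nilpotent_orbit_block:
  fixes T :: "'a::zero \<Rightarrow> 'a"
  assumes "T 0 = 0" "T w \<noteq> 0" "(T ^^ j) w = 0"
  obtains l where "(T ^^ Suc l) w \<noteq> 0" "(T ^^ Suc (Suc l)) w = 0"
proof -
  define i where "i = (LEAST i. (T ^^ i) w = 0)"
  have vanish: "(T ^^ i) w = 0" unfolding i_def using assms(3) by (rule LeastI)
  have nonzero: "(T ^^ l) w \<noteq> 0" if "l < i" for l using not_less_Least that unfolding i_def by blast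
  have "(T ^^ 0) w \<noteq> 0" "(T ^^ 1) w \<noteq> 0" using assms(1,2) by auto
  then have "i \<noteq> 0" "i \<noteq> 1" using vanish by metis+
  then obtain l where "i = Suc (Suc l)" by (metis One_nat_def nat.exhaust)
  then show ?thesis using that vanish nonzero[of "Suc l"] by blast
qed

lemma exists_opposite_powers:
  assumes "r \<noteq> (s::nat)" obtains \<zeta> :: complex where "\<zeta> \<noteq> 0" "\<zeta> ^ r + \<zeta> ^ s = 0"
proof -
  have "\<exists>\<zeta>::complex. \<zeta> \<noteq> 0 \<and> \<zeta> ^ r + \<zeta> ^ s = 0" if "r < s" for r s :: nat
  proof -
    define \<zeta> where "\<zeta> = cis (pi / real (s - r))"
    have "real (s - r) * (pi / real (s - r)) = pi" using that by simp
    then have "\<zeta> ^ (s - r) = -1" by (simp only: \<zeta>_def Complex.DeMoivre cis_pi)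
    moreover have "\<zeta> ^ s = \<zeta> ^ r * \<zeta> ^ (s - r)" using that by (simp flip: power_add)
    ultimately have "\<zeta> ^ r + \<zeta> ^ s = 0" by simp
    then show ?thesis by (intro exI[of _ \<zeta>]) (simp add: \<zeta>_def)
  qed
  from this[of r s] this[of s r] assms show ?thesis
    by (metis that add.commute nat_neq_iff)
qed

context complex_banach
begin

lemma rank_one_sandwich_powers:
  assumes "bop A" "bop B" "rank_one A \<or> rank_one B" "0 < r + s"
  shows "rank_one (sandwich r s A B)"
  using assms(3)
proof
  assume "rank_one B"
  then show ?thesis
    unfolding sandwich_def using assms(1) by (intro rank_one_comp_right rank_one_comp_left bop_funpow)
next
  assume "rank_one A"
  then have "rank_one (A ^^ Suc j)" for j by (simp only: rank_one_funpow rank_one_scale)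
  moreover obtain j where "r = Suc j \<or> s = Suc j" using assms(4) by (cases r; cases s) auto
  ultimately have "rank_one (A ^^ r) \<or> rank_one (A ^^ s)" by metis
  then show ?thesis
    unfolding sandwich_def
    using assms(1,2) rank_one_comp_right rank_one_comp_left bop_funpow bop_comp by metis
qed

lemma tr_sandwich:
  assumes "bop A" "bop B" "rank_one A \<or> rank_one B"
  shows "tr (sandwich r s A B) = tr (A ^^ (r + s) \<circ> B)"
proof (cases s)
  case (Suc j)
  have "rank_one (B \<circ> A ^^ s)"
    using rank_one_sandwich_powers[OF assms, of 0 s] Suc by (simp add: sandwich_def)
  then have "tr (A ^^ r \<circ> (B \<circ> A ^^ s)) = tr ((B \<circ> A ^^ s) \<circ> A ^^ r)"
    by (rule tr_comp_commute) (rule bop_funpow[OF assms(1)])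
  then have "tr (sandwich r s A B) = tr ((B \<circ> A ^^ s) \<circ> A ^^ r)" by (simp only: sandwich_def comp_assoc)
  also have "\<dots> = tr (B \<circ> A ^^ Suc (r + j))" by (simp add: Suc comp_assoc add.commute flip: funpow_add)
  also have "\<dots> = tr (A ^^ Suc (r + j) \<circ> B)"
    using assms(3)
  proof
    assume "rank_one A"
    then have "rank_one (A ^^ Suc (r + j))" by (simp only: rank_one_funpow rank_one_scale)
    then show ?thesis using assms(2) by (rule tr_comp_commute)
  next
    assume "rank_one B"
    then show ?thesis by (rule tr_comp_commute[symmetric]) (rule bop_funpow[OF assms(1)])
  qed
  finally show ?thesis by (simp add: Suc)
qed (simp add: sandwich_def)

lemma funpow_eigenvector: "bop U \<Longrightarrow> U v = smul c v \<Longrightarrow> (U ^^ j) v = smul (c ^ j) v"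
  by (induction j) (auto simp: bopD mult.commute)

lemma sandwich_eigen:
  assumes "bop U" "bop T" "w \<in> dual" "\<And>u. w (U u) = c * w u" "U v = smul d v"
  shows "w (sandwich r s U T v) = c ^ r * d ^ s * w (T v)"
  using assms
  by (simp add: sandwich_def funpow_left_eigenvector[of w U c] funpow_eigenvector[of U v d] bopD dualD)

lemma rank_two_minor_zero:
  assumes "rank_one R" "rank_one S" "f \<in> dual" "g \<in> dual" "h \<in> dual" and T_sum: "T = R \<boxplus> S"
  shows "f (T u) * (g (T v) * h (T w) - g (T w) * h (T v)) - f (T v) * (g (T u) * h (T w) - g (T w) * h (T u))
    + f (T w) * (g (T u) * h (T v) - g (T v) * h (T u)) = 0"
proof -
  obtain a b c d where "R = a \<odot> b" "S = c \<odot> d" using assms(1,2) by (metis rank_oneE)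
  then show ?thesis using assms(3-5) by (simp add: T_sum tensor_apply dualD algebra_simps)
qed

text \<open>In the basis x, z, e the operator T is the direct sum of \<open>\<xi>\<close> and of a nonzero nilpotent block whose
  entries are all nonzero, and f, k, h are the coordinate functionals.\<close>

definition jordan_frame ::
  "('a \<Rightarrow> 'a) \<Rightarrow> complex \<Rightarrow> 'a \<Rightarrow> 'a \<Rightarrow> 'a \<Rightarrow> ('a \<Rightarrow> complex) \<Rightarrow> ('a \<Rightarrow> complex) \<Rightarrow> ('a \<Rightarrow> complex) \<Rightarrow> bool" where
  "jordan_frame T \<xi> x z e f k h \<longleftrightarrow>
     \<xi> \<noteq> 0 \<and> T x = smul \<xi> x \<and> T z = e - z \<and> T e = e - z \<and>
     f \<in> dual \<and> f x = 1 \<and> f z = 0 \<and> f e = 0 \<and>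
     k \<in> dual \<and> k x = 0 \<and> k z = 1 \<and> k e = 0 \<and>
     h \<in> dual \<and> h x = 0 \<and> h z = 0 \<and> h e = 1"

lemma jordan_frame_if_nilpotent_block:
  assumes bop_T: "bop T" and f_normalized: "f \<in> dual" "f x = 1"
    and eigenvector: "T x = smul \<xi> x" "\<xi> \<noteq> 0"
    and nilpotent_z: "f z = 0" "f (T z) = 0" "T z \<noteq> 0" "T (T z) = 0"
  shows "\<exists>z e k h. jordan_frame T \<xi> x z e f k h"
proof -
  define y where "y = T z"
  have "T (smul t y) \<noteq> T z" for t using nilpotent_z(3,4) bop_T by (simp add: y_def bopD)
  then have "z \<noteq> smul t y" for t by metis
  then obtain \<alpha> \<gamma> where biorthogonal: "\<alpha> \<in> dual" "\<gamma> \<in> dual" "\<alpha> y = 1" "\<alpha> z = 0" "\<gamma> y = 0" "\<gamma> z = 1"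
    using exists_biorthogonal_pair[of y z] nilpotent_z(3) by (metis y_def)
  define h where "h u = \<alpha> u - \<alpha> x * f u" for u
  define g where "g u = \<gamma> u - \<gamma> x * f u" for u
  have dual: "h \<in> dual" "(\<lambda>u. g u - h u) \<in> dual"
    using biorthogonal(1,2) f_normalized(1) unfolding h_def g_def by (auto intro!: dual_diff dual_scale)
  have "jordan_frame T \<xi> x z (y + z) f (\<lambda>u. g u - h u) h"
    unfolding jordan_frame_def
    using dual bop_T f_normalized eigenvector nilpotent_z biorthogonal
    by (auto simp: h_def g_def y_def bopD dualD)
  then show ?thesis by blast
qed

lemma rank_one_root_eigen:
  assumes bop_T: "bop T" and f_normalized: "f \<in> dual" "f x = 1" and root: "T ^^ Suc j = x \<odot> f"
  obtains \<xi> where "\<xi> \<noteq> 0" "T x = smul \<xi> x" "\<And>u. f (T u) = \<xi> * f u"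
proof -
  have commute: "smul (f u) (T x) = smul (f (T u)) x" for u
  proof -
    have "T ((T ^^ Suc j) u) = (T ^^ Suc j) (T u)" by (simp add: funpow_swap1)
    then show ?thesis unfolding root using bop_T by (simp add: tensor_apply bopD)
  qed
  define \<xi> where "\<xi> = f (T x)"
  have T_x: "T x = smul \<xi> x" using commute[of x] f_normalized(2) by (simp add: \<xi>_def)
  have "x \<noteq> 0" using f_normalized dualD(4) by fastforce
  have "smul (\<xi> ^ Suc j) x = smul 1 x"
    using funpow_eigenvector[OF bop_T T_x, of "Suc j"] f_normalized(2) unfolding root
    by (simp add: tensor_apply)
  then have "\<xi> ^ Suc j = 1" using \<open>x \<noteq> 0\<close> by (metis cv.scale_right_imp_eq)
  then have "\<xi> \<noteq> 0" by auto
  moreover have "f (T u) = \<xi> * f u" for u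
    using commute[of u] \<open>x \<noteq> 0\<close> by (simp add: T_x mult.commute)
  ultimately show ?thesis using that T_x by blast
qed

lemma rank_one_or_jordan_frame:
  assumes bop_T: "bop T" and root: "rank_one (T ^^ Suc j)" "tr (T ^^ Suc j) = 1"
  shows "rank_one T \<or> (\<exists>\<xi> x z e f k h. jordan_frame T \<xi> x z e f k h)"
proof -
  obtain x f where f_dual: "f \<in> dual" and power: "T ^^ Suc j = x \<odot> f" using root(1) by (rule rank_oneE)
  have f_x: "f x = 1" using root(2) by (simp only: power tr_tensor[OF f_dual])
  obtain \<xi> where eigenvalue: "\<xi> \<noteq> 0" "T x = smul \<xi> x" "\<And>u. f (T u) = \<xi> * f u"
    using rank_one_root_eigen[OF bop_T f_dual f_x power] by blast
  show ?thesis
  proof (cases "\<forall>w. f w = 0 \<longrightarrow> T w = 0")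
    case True
    have "T u = (smul \<xi> x \<odot> f) u" for u
    proof -
      have "T (u - smul (f u) x) = 0" using True f_dual f_x by (simp add: dualD)
      then show ?thesis using bop_T eigenvalue(2) by (simp add: bopD tensor_apply mult.commute)
    qed
    then have "T = smul \<xi> x \<odot> f" by (rule ext)
    then show ?thesis using f_dual by (metis rank_one_tensor)
  next
    case False
    then obtain w where w_nilpotent: "f w = 0" "T w \<noteq> 0" by blast
    have "(T ^^ Suc j) w = 0" by (simp only: power tensor_apply w_nilpotent(1) cv.scale_zero_left)
    then obtain l where block: "(T ^^ Suc l) w \<noteq> 0" "(T ^^ Suc (Suc l)) w = 0"
      using nilpotent_orbit_block[of T w "Suc j"] bopD(4)[OF bop_T] w_nilpotent(2) by blast
    define z where "z = (T ^^ l) w"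
    have "f z = 0" "f (T z) = 0"
      using funpow_left_eigenvector[of f T \<xi> l w] w_nilpotent(1) by (simp_all add: z_def eigenvalue(3))
    moreover have "T z \<noteq> 0" "T (T z) = 0" using block by (simp_all add: z_def)
    ultimately show ?thesis
      using jordan_frame_if_nilpotent_block[OF bop_T f_dual f_x eigenvalue(2,1)] by blast
  qed
qed

end

section \<open>Preservers of generalized products\<close>

locale product_preserver = standard_algebra smul \<A>
  for smul :: "complex \<Rightarrow> 'a::banach \<Rightarrow> 'a" and \<A> +
  fixes \<phi> :: "('a \<Rightarrow> 'a) \<Rightarrow> 'a \<Rightarrow> 'a" and r s n :: nat
  assumes maps: "A \<in> \<A> \<Longrightarrow> \<phi> A \<in> \<A>" and exponents: "r + s = Suc n"
    and rank_two_in_range: "rank_one R \<Longrightarrow> rank_one S \<Longrightarrow> R \<boxplus> S \<in> \<phi> ` \<A>"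
    and product: "A \<in> \<A> \<Longrightarrow> B \<in> \<A> \<Longrightarrow> rank_one A \<or> rank_one B \<Longrightarrow>
      \<exists>\<theta>. jordan \<theta> \<and> sandwich r s (\<phi> A) (\<phi> B) = \<theta> (sandwich r s A B)"
begin

lemma product_rank_one:
  assumes "A \<in> \<A>" "B \<in> \<A>" "rank_one A \<or> rank_one B"
  shows "rank_one (sandwich r s (\<phi> A) (\<phi> B))" "tr (sandwich r s (\<phi> A) (\<phi> B)) = tr (A ^^ Suc n \<circ> B)"
proof -
  obtain \<theta> where jordan_\<theta>: "jordan \<theta>" "sandwich r s (\<phi> A) (\<phi> B) = \<theta> (sandwich r s A B)"
    using product[OF assms] by blast
  have "rank_one (sandwich r s A B)"
    using exponents by (intro rank_one_sandwich_powers algebra_bop assms) simp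
  then show "rank_one (sandwich r s (\<phi> A) (\<phi> B))" "tr (sandwich r s (\<phi> A) (\<phi> B)) = tr (A ^^ Suc n \<circ> B)"
    using assms algebra_bop jordan_\<theta>(1)
    by (simp_all only: jordan_\<theta>(2) jordan_rank_one jordan_tr tr_sandwich exponents)
qed

sublocale power_trace_map smul \<A> \<phi> n
proof
  fix A B assume "A \<in> \<A>" "B \<in> \<A>" "rank_one A \<or> rank_one B" "rank_one (\<phi> A) \<or> rank_one (\<phi> B)"
  then show "tr (\<phi> A ^^ Suc n \<circ> \<phi> B) = tr (A ^^ Suc n \<circ> B)"
    using product_rank_one(2)[of A B] algebra_bop maps by (simp only: tr_sandwich exponents)
qed (rule maps rank_two_in_range; assumption)+

lemma no_jordan_frame:
  assumes rank_one_P: "rank_one P"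
  shows "\<not> jordan_frame (\<phi> P) \<xi> x z e f k h"
proof
  assume frame: "jordan_frame (\<phi> P) \<xi> x z e f k h"
  then have dual: "f \<in> dual" "h \<in> dual" by (simp_all add: jordan_frame_def)
  define U where "U = x \<odot> f \<boxplus> e \<odot> h"
  have "U \<in> \<phi> ` \<A>" unfolding U_def by (intro rank_two_in_range rank_one_tensor dual)
  then obtain C where preimage: "U = \<phi> C" "C \<in> \<A>" by (rule imageE)
  let ?W = "sandwich r s U (\<phi> P)"
  have "rank_one ?W"
    using product_rank_one(1)[OF preimage(2) algebra_rank_one[OF rank_one_P]] rank_one_P
    by (simp add: preimage(1))
  then have minor: "f (?W x) * h (?W e) = f (?W e) * h (?W x)" by (rule rank_one_minor_zero[OF _ dual])
  have bop: "bop U" "bop (\<phi> P)" using preimage image_bop algebra_rank_one[OF rank_one_P] by auto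
  have left: "f (U u) = 1 * f u" "h (U u) = 1 * h u" for u
    using frame by (simp_all add: jordan_frame_def U_def tensor_apply dualD)
  have right: "U x = smul 1 x" "U e = smul 1 e"
    using frame by (simp_all add: jordan_frame_def U_def tensor_apply)
  have "f (?W x) = \<xi>" "f (?W e) = 0" "h (?W e) = 1"
    using frame
    by (simp_all add: sandwich_eigen[OF bop dual(1) left(1) right(1)]
        sandwich_eigen[OF bop dual(1) left(1) right(2)] sandwich_eigen[OF bop dual(2) left(2) right(2)]
        jordan_frame_def dualD)
  then show False using minor frame by (simp add: jordan_frame_def)
qed

sublocale idempotent_rank_preserver smul \<A> \<phi> n
proof
  fix P assume idempotent_P: "rank_one P" "tr P = 1"
  then have "P ^^ Suc n \<circ> P = P" by (simp only: rank_one_funpow rank_one_square power_one cv.scale_one)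
  then have "rank_one (\<phi> P ^^ Suc (Suc n))" "tr (\<phi> P ^^ Suc (Suc n)) = 1"
    using product_rank_one[OF algebra_rank_one[OF idempotent_P(1)]
        algebra_rank_one[OF idempotent_P(1)]] idempotent_P
    by (simp_all add: sandwich_self exponents del: funpow.simps)
  then show "rank_one (\<phi> P)"
    using rank_one_or_jordan_frame image_bop[OF algebra_rank_one[OF idempotent_P(1)]]
      no_jordan_frame[OF idempotent_P(1)] by blast
qed

end

locale jordan_product_preserver = standard_algebra smul \<A>
  for smul :: "complex \<Rightarrow> 'a::banach \<Rightarrow> 'a" and \<A> +
  fixes \<phi> :: "('a \<Rightarrow> 'a) \<Rightarrow> 'a \<Rightarrow> 'a" and r s n :: nat
  assumes maps: "A \<in> \<A> \<Longrightarrow> \<phi> A \<in> \<A>" and exponents: "r + s = Suc n"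
    and rank_three_in_range: "rank_one R \<Longrightarrow> rank_one S \<Longrightarrow> rank_one T \<Longrightarrow> R \<boxplus> S \<boxplus> T \<in> \<phi> ` \<A>"
    and jordan_product: "A \<in> \<A> \<Longrightarrow> B \<in> \<A> \<Longrightarrow> rank_one A \<or> rank_one B \<Longrightarrow>
      \<exists>\<theta>. jordan \<theta> \<and> sandwich r s (\<phi> A) (\<phi> B) \<boxplus> sandwich s r (\<phi> A) (\<phi> B) =
        \<theta> (sandwich r s A B \<boxplus> sandwich s r A B)"
begin

lemma exponents_swap: "s + r = Suc n"
  and exponents_pos: "0 < r + s" "0 < s + r"
  using exponents by linarith+

lemma jordan_product_rank_ones:
  assumes "A \<in> \<A>" "B \<in> \<A>" "rank_one A \<or> rank_one B"
  obtains R S where "rank_one R" "rank_one S" "tr R = tr (A ^^ Suc n \<circ> B)" "tr S = tr (A ^^ Suc n \<circ> B)"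
    "sandwich r s (\<phi> A) (\<phi> B) \<boxplus> sandwich s r (\<phi> A) (\<phi> B) = R \<boxplus> S"
proof -
  obtain \<theta> where jordan_\<theta>: "jordan \<theta>" "sandwich r s (\<phi> A) (\<phi> B) \<boxplus> sandwich s r (\<phi> A) (\<phi> B) =
      \<theta> (sandwich r s A B \<boxplus> sandwich s r A B)"
    using jordan_product[OF assms] by blast
  have rank_one: "rank_one (sandwich r s A B)" "rank_one (sandwich s r A B)"
    by (intro rank_one_sandwich_powers algebra_bop assms exponents_pos)+
  note add = jordan_add[OF jordan_\<theta>(1) algebra_rank_one[OF rank_one(1)]
      algebra_rank_one[OF rank_one(2)]]
  have "tr (sandwich r s A B) = tr (A ^^ Suc n \<circ> B)" "tr (sandwich s r A B) = tr (A ^^ Suc n \<circ> B)"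
    using assms algebra_bop by (simp_all only: tr_sandwich exponents exponents_swap)
  then show ?thesis
    using rank_one jordan_\<theta> by (intro that[of "\<theta> (sandwich r s A B)" "\<theta> (sandwich s r A B)"])
      (simp_all only: jordan_rank_one jordan_tr add)
qed

sublocale power_trace_map smul \<A> \<phi> n
proof
  show "R \<boxplus> S \<in> \<phi> ` \<A>" if "rank_one R" "rank_one S" for R S
    using rank_three_in_range[OF that rank_one_zero] by simp
  fix A B assume algebra: "A \<in> \<A>" "B \<in> \<A>" "rank_one A \<or> rank_one B"
    and image: "rank_one (\<phi> A) \<or> rank_one (\<phi> B)"
  have bop: "bop (\<phi> A)" "bop (\<phi> B)" using algebra(1,2) algebra_bop maps by blast+
  obtain R S where sum_RS: "rank_one R" "rank_one S" "tr R = tr (A ^^ Suc n \<circ> B)"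
    "tr S = tr (A ^^ Suc n \<circ> B)"
    "sandwich r s (\<phi> A) (\<phi> B) \<boxplus> sandwich s r (\<phi> A) (\<phi> B) = R \<boxplus> S"
    using jordan_product_rank_ones[OF algebra] by blast
  have "tr (\<phi> A ^^ Suc n \<circ> \<phi> B) + tr (\<phi> A ^^ Suc n \<circ> \<phi> B) =
      tr (sandwich r s (\<phi> A) (\<phi> B)) + tr (sandwich s r (\<phi> A) (\<phi> B))"
    by (simp only: tr_sandwich[OF bop image] exponents exponents_swap)
  also have "\<dots> = tr (sandwich r s (\<phi> A) (\<phi> B) \<boxplus> sandwich s r (\<phi> A) (\<phi> B))"
    by (intro tr_add[symmetric] rank_one_sandwich_powers bop image exponents_pos)
  also have "\<dots> = tr (R \<boxplus> S)" by (simp only: sum_RS(5))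
  also have "\<dots> = tr (A ^^ Suc n \<circ> B) + tr (A ^^ Suc n \<circ> B)" by (simp only: tr_add sum_RS(1-4))
  finally show "tr (\<phi> A ^^ Suc n \<circ> \<phi> B) = tr (A ^^ Suc n \<circ> B)" by simp
qed (rule maps)

lemma product_preserver_if_equal_exponents:
  assumes "r = s"
  shows "product_preserver smul \<A> \<phi> r s n"
proof
  fix A B assume algebra: "A \<in> \<A>" "B \<in> \<A>" "rank_one A \<or> rank_one B"
  let ?V = "sandwich r s A B" and ?W = "sandwich r s (\<phi> A) (\<phi> B)"
  obtain \<theta> where jordan_\<theta>: "jordan \<theta>" "?W \<boxplus> ?W = \<theta> (?V \<boxplus> ?V)"
    using jordan_product[OF algebra] assms by blast
  have "?V \<in> \<A>"
    by (intro algebra_rank_one rank_one_sandwich_powers algebra_bop algebra exponents_pos)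
  then have "?W \<boxplus> ?W = \<theta> ?V \<boxplus> \<theta> ?V" by (simp only: jordan_\<theta>(2) jordan_add[OF jordan_\<theta>(1)])
  then have "?W = \<theta> ?V" by (rule op_double_cancel)
  then show "\<exists>\<theta>. jordan \<theta> \<and> ?W = \<theta> ?V" using jordan_\<theta>(1) by blast
qed (simp_all add: maps exponents rank_two_in_range)

text \<open>The operator U is diagonal in the frame. Choosing \<open>\<zeta>\<^sup>r + \<zeta>\<^sup>s = 0\<close> cancels the off-diagonal entries of
  \<open>U\<^sup>r T U\<^sup>s + U\<^sup>s T U\<^sup>r\<close>, which thus has rank three, but it must be a sum of two rank one operators.\<close>

lemma no_jordan_frame:
  assumes rank_one_P: "rank_one P" and "r \<noteq> s"
  shows "\<not> jordan_frame (\<phi> P) \<xi> x z e f k h"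
proof
  assume frame: "jordan_frame (\<phi> P) \<xi> x z e f k h"
  then have dual: "f \<in> dual" "k \<in> dual" "h \<in> dual" by (simp_all add: jordan_frame_def)
  obtain \<zeta> :: complex where opposite_powers: "\<zeta> \<noteq> 0" "\<zeta> ^ r + \<zeta> ^ s = 0"
    using \<open>r \<noteq> s\<close> by (rule exists_opposite_powers)
  define U where "U = x \<odot> f \<boxplus> z \<odot> k \<boxplus> smul \<zeta> e \<odot> h"
  have "U \<in> \<phi> ` \<A>" unfolding U_def by (intro rank_three_in_range rank_one_tensor dual)
  then obtain C where preimage: "U = \<phi> C" "C \<in> \<A>" by (rule imageE)
  define W where "W = sandwich r s U (\<phi> P) \<boxplus> sandwich s r U (\<phi> P)"
  obtain R S where W_rank_two: "rank_one R" "rank_one S" "W = R \<boxplus> S"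
    using jordan_product_rank_ones[OF preimage(2) algebra_rank_one[OF rank_one_P] disjI2[OF rank_one_P]]
      unfolding W_def preimage(1) by blast
  have bop: "bop U" "bop (\<phi> P)" using preimage image_bop algebra_rank_one[OF rank_one_P] by auto
  have W_entry: "w (W v) = (c ^ r * d ^ s + c ^ s * d ^ r) * w (\<phi> P v)"
    if "w \<in> dual" "\<And>u. w (U u) = c * w u" "U v = smul d v" for w v c d
    using sandwich_eigen[OF bop that] by (simp add: W_def dualD[OF that(1)] algebra_simps)
  have left: "f (U u) = 1 * f u" "k (U u) = 1 * k u" "h (U u) = \<zeta> * h u" for u
    using frame by (simp_all add: jordan_frame_def U_def tensor_apply dualD)
  have right: "U x = smul 1 x" "U z = smul 1 z" "U e = smul \<zeta> e"
    using frame by (simp_all add: jordan_frame_def U_def tensor_apply)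
  note entries = W_entry[OF dual(1) left(1)] W_entry[OF dual(2) left(2)] W_entry[OF dual(3) left(3)]
  have "f (W x) = 2 * \<xi>" "f (W z) = 0" "f (W e) = 0"
    "k (W x) = 0" "k (W z) = - 2" "k (W e) = 0"
    "h (W x) = 0" "h (W z) = 0" "h (W e) = 2 * \<zeta> ^ (r + s)"
    using frame opposite_powers(2)
    by (simp_all add: entries[OF right(1)] entries[OF right(2)] entries[OF right(3)]
        jordan_frame_def dualD power_add add.commute)
  then have "(2 * \<xi>) * ((- 2) * (2 * \<zeta> ^ (r + s))) = 0"
    using rank_two_minor_zero[OF W_rank_two(1,2) dual W_rank_two(3), of x z e] by simp
  then show False using frame opposite_powers(1) by (simp add: jordan_frame_def)
qed

sublocale idempotent_rank_preserver smul \<A> \<phi> n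
proof
  fix P assume idempotent_P: "rank_one P" "tr P = 1"
  show "rank_one (\<phi> P)"
  proof (cases "r = s")
    case True
    then interpret product_preserver smul \<A> \<phi> r s n by (rule product_preserver_if_equal_exponents)
    show ?thesis by (rule rank_one_image_idempotent[OF idempotent_P])
  next
    case False
    have P_algebra: "P \<in> \<A>" by (rule algebra_rank_one[OF idempotent_P(1)])
    let ?Q = "\<phi> P ^^ Suc (Suc n)"
    have self: "sandwich r s T T = T ^^ Suc (Suc n)" "sandwich s r T T = T ^^ Suc (Suc n)"
      for T :: "'a \<Rightarrow> 'a"
      by (simp_all only: sandwich_self exponents exponents_swap)
    have P_power: "P ^^ Suc (Suc n) = P"
      using idempotent_P by (simp only: rank_one_funpow power_one cv.scale_one)
    obtain \<theta> where jordan_\<theta>: "jordan \<theta>" "?Q \<boxplus> ?Q = \<theta> (P \<boxplus> P)"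
      using jordan_product[OF P_algebra P_algebra disjI1[OF idempotent_P(1)]] unfolding self P_power
      by blast
    have "?Q \<boxplus> ?Q = \<theta> P \<boxplus> \<theta> P"
      by (simp only: jordan_\<theta>(2) jordan_add[OF jordan_\<theta>(1) P_algebra P_algebra])
    then have "?Q = \<theta> P" by (rule op_double_cancel)
    then have "rank_one ?Q" "tr ?Q = 1"
      using jordan_rank_one[OF jordan_\<theta>(1) idempotent_P(1)] jordan_tr[OF jordan_\<theta>(1) idempotent_P(1)]
        idempotent_P(2) by simp_all
    then show ?thesis
      using rank_one_or_jordan_frame image_bop[OF P_algebra] no_jordan_frame[OF idempotent_P(1) False]
      by blast
  qed
qed

end

lemma gen_prod_constant:
  assumes "\<And>j. j \<in> set xs \<Longrightarrow> a j = A"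
  shows "gen_prod (xs @ ys) a = A ^^ length xs \<circ> gen_prod ys a"
  using assms by (induction xs) (auto simp: gen_prod_def comp_assoc)

lemma gen_prod_sandwich:
  assumes "p \<notin> set xs" "p \<notin> set ys"
  shows "gen_prod (xs @ p # ys) (\<lambda>j. G (if j = p then B else A)) =
      sandwich (length xs) (length ys) (G A) (G B)"
proof -
  let ?a = "\<lambda>j. G (if j = p then B else A)"
  have "gen_prod (xs @ p # ys) ?a = G A ^^ length xs \<circ> gen_prod (p # ys) ?a"
    using assms(1) by (intro gen_prod_constant) auto
  moreover have "gen_prod (p # ys) ?a = G B \<circ> gen_prod (ys @ []) ?a" by (simp add: gen_prod_def)
  moreover have "gen_prod (ys @ []) ?a = G A ^^ length ys \<circ> gen_prod [] ?a"
    using assms(2) by (intro gen_prod_constant) auto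
  ultimately show ?thesis by (simp add: gen_prod_def sandwich_def comp_assoc)
qed

lemma split_at_single_occurrence:
  assumes "\<exists>p<length xs. length (filter (\<lambda>j. j = xs ! p) xs) = 1"
  obtains p ys zs where "xs = ys @ p # zs" "p \<notin> set ys" "p \<notin> set zs"
proof -
  obtain i where single_occurrence: "i < length xs" "length (filter (\<lambda>j. j = xs ! i) xs) = 1"
    using assms by blast
  have split: "xs = take i xs @ xs ! i # drop (Suc i) xs"
    by (rule id_take_nth_drop[OF single_occurrence(1)])
  have "length (filter (\<lambda>j. j = xs ! i) (take i xs @ xs ! i # drop (Suc i) xs)) = 1"
    using single_occurrence(2) split by metis
  then have "xs ! i \<notin> set (take i xs)" "xs ! i \<notin> set (drop (Suc i) xs)"
    by (auto simp: filter_empty_conv)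
  then show ?thesis using that split by blast
qed

context standard_algebra
begin

context
  fixes \<phi> :: "('a \<Rightarrow> 'a) \<Rightarrow> 'a \<Rightarrow> 'a" and "is" xs ys :: "nat list" and I :: "nat set" and p q n :: nat
  assumes maps: "\<forall>A\<in>\<A>. \<phi> A \<in> \<A>"
    and split: "is = xs @ p # ys" "p \<notin> set xs" "p \<notin> set ys" and indices: "set is = I"
    and q: "q \<in> I" "q \<noteq> p" and length: "length xs + length ys = Suc n"
begin

lemma gen_prod_substitution:
  "gen_prod is (\<lambda>j. G (if j = p then B else A)) = sandwich (length xs) (length ys) (G A) (G B)"
  using gen_prod_sandwich[OF split(2,3)] by (simp only: split(1))

lemma gen_jordan_prod_substitution:
  "gen_jordan_prod is (\<lambda>j. G (if j = p then B else A)) =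
    sandwich (length xs) (length ys) (G A) (G B) \<boxplus> sandwich (length ys) (length xs) (G A) (G B)"
  using gen_prod_sandwich[OF split(2,3), of G B A] gen_prod_sandwich[of p "rev ys" "rev xs" G B A]
    split(2,3)
  by (simp add: gen_jordan_prod_def split(1))

lemma substitution_admissible:
  assumes "A \<in> \<A>" "B \<in> \<A>" "rank_one A \<or> rank_one B"
  shows "(\<forall>j\<in>I. (if j = p then B else A) \<in> \<A>) \<and>
    (\<exists>j\<in>I. rank_le smul (if j = p then B else A) 1)"
  using assms(3)
proof
  assume "rank_one A"
  then show ?thesis using assms(1,2) q rank_le_rank_one by (intro conjI bexI[of _ q]) simp_all
next
  assume "rank_one B"
  then show ?thesis
    using assms(1,2) indices split(1) rank_le_rank_one by (intro conjI bexI[of _ p]) auto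
qed

lemma product_preserver_if_gen_prod:
  assumes range: "{T. bop T \<and> rank_le smul T 2} \<subseteq> \<phi> ` \<A>"
    and product: "\<forall>a. (\<forall>j\<in>I. a j \<in> \<A>) \<and> (\<exists>j\<in>I. rank_le smul (a j) 1) \<longrightarrow>
      (\<exists>\<theta>. algebra_automorphism smul \<A> \<theta> \<and> gen_prod is (\<lambda>j. \<phi> (a j)) = \<theta> (gen_prod is a))"
  shows "product_preserver smul \<A> \<phi> (length xs) (length ys) n"
proof
  show "R \<boxplus> S \<in> \<phi> ` \<A>" if "rank_one R" "rank_one S" for R S
    using that rank_le_add[of R 1 S 1] rank_le_rank_one bop_rank_one
    by (intro subsetD[OF range] CollectI conjI bop_add) (simp_all add: numeral_2_eq_2)
  fix A B assume algebra: "A \<in> \<A>" "B \<in> \<A>" "rank_one A \<or> rank_one B"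
  obtain \<theta> where "algebra_automorphism smul \<A> \<theta>"
    "gen_prod is (\<lambda>j. \<phi> (if j = p then B else A)) = \<theta> (gen_prod is (\<lambda>j. if j = p then B else A))"
    using product[rule_format, OF substitution_admissible[OF algebra]] by blast
  then show "\<exists>\<theta>. jordan \<theta> \<and> sandwich (length xs) (length ys) (\<phi> A) (\<phi> B) =
      \<theta> (sandwich (length xs) (length ys) A B)"
    using algebra_automorphism_jordan gen_prod_substitution[of \<phi>] gen_prod_substitution[of "\<lambda>T. T"]
    by metis
qed (simp_all add: maps length)

lemma jordan_product_preserver_if_gen_jordan_prod:
  assumes range: "{T. bop T \<and> rank_le smul T 3} \<subseteq> \<phi> ` \<A>"
    and product: "\<forall>a. (\<forall>j\<in>I. a j \<in> \<A>) \<and> (\<exists>j\<in>I. rank_le smul (a j) 1) \<longrightarrow>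
      (\<exists>\<theta>. jordan \<theta> \<and> gen_jordan_prod is (\<lambda>j. \<phi> (a j)) = \<theta> (gen_jordan_prod is a))"
  shows "jordan_product_preserver smul \<A> \<phi> (length xs) (length ys) n"
proof
  show "R \<boxplus> S \<boxplus> T \<in> \<phi> ` \<A>" if "rank_one R" "rank_one S" "rank_one T" for R S T
    using that rank_le_add[OF rank_le_add[of R 1 S 1], of T 1] rank_le_rank_one bop_rank_one
    by (intro subsetD[OF range] CollectI conjI bop_add) (simp_all add: numeral_3_eq_3)
  fix A B assume algebra: "A \<in> \<A>" "B \<in> \<A>" "rank_one A \<or> rank_one B"
  show "\<exists>\<theta>. jordan \<theta> \<and>
      sandwich (length xs) (length ys) (\<phi> A) (\<phi> B) \<boxplus> sandwich (length ys) (length xs) (\<phi> A) (\<phi> B) =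
      \<theta> (sandwich (length xs) (length ys) A B \<boxplus> sandwich (length ys) (length xs) A B)"
    using product[rule_format, OF substitution_admissible[OF algebra]]
    by (simp only: gen_jordan_prod_substitution[of \<phi>] gen_jordan_prod_substitution[of "\<lambda>T. T"])
qed (simp_all add: maps length)

end

end

theorem theorem2p4:
  fixes smul :: "complex \<Rightarrow> 'a::banach \<Rightarrow> 'a"
    and \<A> :: "('a \<Rightarrow> 'a) set"
    and "is" :: "nat list" and k :: nat
    and \<phi> :: "('a \<Rightarrow> 'a) \<Rightarrow> ('a \<Rightarrow> 'a)"
  assumes cb: "complex_banach_scaling smul"
    and soa: "standard_operator_algebra smul \<A>"
    and k2: "k \<ge> 2"
    and idx: "set is = {1..k}"
    and once: "\<exists>p<length is. length (filter (\<lambda>j. j = is ! p) is) = 1"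
    and maps: "\<forall>A\<in>\<A>. \<phi> A \<in> \<A>"
    and hyp:
      "({T. bounded_clinear_op smul T \<and> rank_le smul T 2} \<subseteq> \<phi> ` \<A> \<and>
        (\<forall>a. (\<forall>j\<in>{1..k}. a j \<in> \<A>) \<and> (\<exists>j\<in>{1..k}. rank_le smul (a j) 1) \<longrightarrow>
          (\<exists>\<theta>. algebra_automorphism smul \<A> \<theta> \<and>
                gen_prod is (\<lambda>j. \<phi> (a j)) = \<theta> (gen_prod is a))))
       \<or>
       ({T. bounded_clinear_op smul T \<and> rank_le smul T 3} \<subseteq> \<phi> ` \<A> \<and>
        (\<forall>a. (\<forall>j\<in>{1..k}. a j \<in> \<A>) \<and> (\<exists>j\<in>{1..k}. rank_le smul (a j) 1) \<longrightarrow>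
          (\<exists>\<theta>. jordan_automorphism smul \<A> \<theta> \<and>
                gen_jordan_prod is (\<lambda>j. \<phi> (a j)) = \<theta> (gen_jordan_prod is a))))"
  shows "\<exists>\<xi>::complex. \<xi> ^ length is = 1 \<and>
     ((\<exists>S. invertible_op smul S \<and>
          (\<forall>A\<in>\<A>. \<phi> A = (\<lambda>x. smul \<xi> (S (A (inv S x)))))) \<or>
      (\<exists>S. invertible_dual_op smul S \<and>
          (\<forall>A\<in>\<A>. \<phi> A = (\<lambda>x. smul \<xi> (S ((inv_into (cdual smul) S x) \<circ> A))))))"
proof -
  interpret standard_algebra smul \<A> by unfold_locales (rule cb, rule soa)
  obtain p xs ys where split: "is = xs @ p # ys" "p \<notin> set xs" "p \<notin> set ys"
    using once by (rule split_at_single_occurrence)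
  obtain q where q: "q \<in> {1..k}" "q \<noteq> p"
    using k2 that[of 1] that[of 2] by (cases "p = 1") auto
  then have "length xs + length ys \<noteq> 0" using idx split(1) by auto
  then obtain n where n: "length xs + length ys = Suc n" using not0_implies_Suc by blast
  from hyp have "idempotent_rank_preserver smul \<A> \<phi> n"
  proof (elim disjE conjE)
    assume range: "{T. bop T \<and> rank_le smul T 2} \<subseteq> \<phi> ` \<A>"
    assume "\<forall>a. (\<forall>j\<in>{1..k}. a j \<in> \<A>) \<and> (\<exists>j\<in>{1..k}. rank_le smul (a j) 1) \<longrightarrow>
      (\<exists>\<theta>. algebra_automorphism smul \<A> \<theta> \<and> gen_prod is (\<lambda>j. \<phi> (a j)) = \<theta> (gen_prod is a))"
    from product_preserver_if_gen_prod[OF maps split idx q n range this]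
    interpret product_preserver smul \<A> \<phi> "length xs" "length ys" n .
    show ?thesis by unfold_locales
  next
    assume range: "{T. bop T \<and> rank_le smul T 3} \<subseteq> \<phi> ` \<A>"
    assume "\<forall>a. (\<forall>j\<in>{1..k}. a j \<in> \<A>) \<and> (\<exists>j\<in>{1..k}. rank_le smul (a j) 1) \<longrightarrow>
      (\<exists>\<theta>. jordan \<theta> \<and> gen_jordan_prod is (\<lambda>j. \<phi> (a j)) = \<theta> (gen_jordan_prod is a))"
    from jordan_product_preserver_if_gen_jordan_prod[OF maps split idx q n range this]
    interpret jordan_product_preserver smul \<A> \<phi> "length xs" "length ys" n .
    show ?thesis by unfold_locales
  qed
  then interpret idempotent_rank_preserver smul \<A> \<phi> n .
  have "length is = n + 2" using n by (simp add: split(1))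
  then show ?thesis using spatial_up_to_scalar by (simp only:)
qed

end
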